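(* Let $A \in K[T,\phi]$. Then $A$ is irreducible if and only if: - $A$ is monoclinic of slope $\mu$, with $\ell_b(\mu)=\ell$; and - the $\mu$-reduction of $A$ is irreducible in $k[T^\ell,\sigma^\ell]$.
   Context: Setting: $p$ is a prime, $k$ is a perfect field of characteristic $p$, $K = k((u))$ is the field of formal Laurent series over $k$ with $u$-adic valuation $v$, $\sigma$ is a power of the Frobenius automorphism of $k$ (possibly $\sigma=\mathrm{id}$), $b\ge 2$ is an integer, and $\phi: K\to K$ is the endomorphism $\phi(\sum_n a_n u^n) = \sum_n \sigma(a_n)u^{bn}$. The ring $K[T,\phi]$ is the set of polynomials $\sum a_iT^i$ with usual addition and multiplication determined by $Ta=\phi(a)T$ for $a\in K$; similarly $k[T,\sigma]$ with $Ta=\sigma(a)T$ for $a \in k$. $k[T^\ell,\sigma^\ell]$ is the ring of skew polynomials in $T^\ell$ with coefficients in $k$, viewed inside $k[T,\sigma]$. Newton polygon: for $A=\sum_{i=0}^d a_iT^i$, the Newton polygon of $A$ is the lower convex hull in $\mathbf{R}^2$ of the points $(b^i, v(a_i))$, $0\le i\le d$ (points with $a_i=0$ being at infinite height). The slopes of $A$ are the slopes of its Newton polygon. $A$ is monoclinic if it has only one slope. Fractional powers of $u$: $\phi$ and $v$ are extended by $\phi(u^{q})=u^{bq}$ and $v(u^q)=q$ for $q\in\mathbf{Q}$. The valuation of a skew polynomial is the minimum of the valuations of its coefficients. $\mu$-reduction: if $\mu$ is a slope of $A$, there is a unique $\nu\in\mathbf{Q}$ such that $u^\nu A u^{-\mu}$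 has valuation $0$; the $\mu$-reduction of $A$ is the reduction of $u^\nu A u^{-\mu}$ modulo the ideal of skew polynomials of positive valuation. $b$-length: for $\mu\in\mathbf{Q}^\times$ write $\mu=b^\alpha\frac{s}{t}$ with $\alpha\in\mathbf{Z}$, $s\in\mathbf{Z}$ and $t\in\mathbf{Z}\setminus\{0\}$ coprime, and $t$ coprime to $b$. The $b$-length $\ell_b(\mu)$ is the order of $b$ modulo $t$ (or $0$ if $t=1$).
   Formalization: A is assumed not to be cT with c≠0 (irreducible but without a slope); when ℓ_b(μ)=0 the ring k[T^ℓ,σ^ℓ] is taken to be k[T,σ], since k itself has no irreducibles (e.g. A=T−u^{b−1}); ℓ_b(0) is set to 0. *)

theory Defs
  imports
    "HOL-Analysis.Analysis"
    "HOL-Algebra.Ring"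
    "HOL-Computational_Algebra.Formal_Laurent_Series"
    "HOL-Number_Theory.Pocklington"
begin

hide_const (open) up_ring.coeff up_ring.monom

section \<open>The endomorphism of the field of Laurent series\<close>

definition frobenius :: "nat \<Rightarrow> 'k \<Rightarrow> 'k::field" where
  "frobenius p x = x ^ p"

definition perfect_of_char :: "nat \<Rightarrow> 'k::field itself \<Rightarrow> bool" where
  "perfect_of_char p _ \<longleftrightarrow> CHAR('k) = p \<and> surj (frobenius p :: 'k \<Rightarrow> 'k)"

text \<open>Powers are taken in the automorphism group of the field, so negative exponents are
  allowed; exponent zero gives the identity.\<close>

definition frobenius_power :: "nat \<Rightarrow> ('k::field \<Rightarrow> 'k) \<Rightarrow> bool" where
  "frobenius_power p \<sigma> \<longleftrightarrow> (\<exists>n::nat. \<sigma> = frobenius p ^^ n \<or> \<sigma> = (inv_into UNIV (frobenius p)) ^^ n)"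

definition phi :: "('k::zero \<Rightarrow> 'k) \<Rightarrow> nat \<Rightarrow> 'k fls \<Rightarrow> 'k fls" where
  "phi \<sigma> b f = Abs_fls (\<lambda>n. if int b dvd n then \<sigma> (fls_nth f (n div int b)) else 0)"

lemma fls_nth_phi:
  assumes "\<sigma> 0 = 0" "b > 0"
  shows "fls_nth (phi \<sigma> b f) n = (if int b dvd n then \<sigma> (fls_nth f (n div int b)) else 0)"
  unfolding phi_def
proof (rule nth_Abs_fls_lower_bound[of "int b * fls_subdegree f"], intro allI impI)
  fix m assume m: "m < int b * fls_subdegree f"
  show "(if int b dvd m then \<sigma> (fls_nth f (m div int b)) else 0) = 0"
    using m assms by (auto elim!: dvdE)
qed

section \<open>Skew polynomial rings\<close>

text \<open>A skew polynomial \<open>\<Sum> a\<^sub>i T\<^sup>i\<close> is stored as the ordinary polynomial with the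
  same coefficients; only the multiplication changes, by the rule \<open>T a = f(a) T\<close>.\<close>

definition skew_mult :: "('a \<Rightarrow> 'a) \<Rightarrow> 'a poly \<Rightarrow> 'a poly \<Rightarrow> 'a::comm_ring_1 poly" where
  "skew_mult f A B =
     (\<Sum>i\<le>degree A. \<Sum>j\<le>degree B. monom (coeff A i * (f ^^ i) (coeff B j)) (i + j))"

definition skew_poly_ring :: "('a \<Rightarrow> 'a) \<Rightarrow> 'a::comm_ring_1 poly ring" where
  "skew_poly_ring f =
     \<lparr>carrier = UNIV, mult = skew_mult f, one = 1, zero = 0, add = (+)\<rparr>"

text \<open>The subring of skew polynomials in \<open>T\<^sup>l\<close>, viewed inside the ring of skew
  polynomials in \<open>T\<close>.\<close>

definition skew_power_subring :: "('a \<Rightarrow> 'a) \<Rightarrow> nat \<Rightarrow> 'a::comm_ring_1 poly ring" where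
  "skew_power_subring f l =
     (skew_poly_ring f)\<lparr>carrier := {A. \<forall>i. coeff A i \<noteq> 0 \<longrightarrow> l dvd i}\<rparr>"

text \<open>\<open>Divisibility.irreducible\<close> is designed for commutative monoids; this is the usual
  two-sided notion for a possibly noncommutative ring.\<close>

definition ring_irred :: "('a, 'm) ring_scheme \<Rightarrow> 'a \<Rightarrow> bool" where
  "ring_irred R a \<longleftrightarrow>
     a \<in> carrier R \<and> a \<noteq> \<zero>\<^bsub>R\<^esub> \<and> a \<notin> Units R \<and>
     (\<forall>x\<in>carrier R. \<forall>y\<in>carrier R. a = x \<otimes>\<^bsub>R\<^esub> y \<longrightarrow> x \<in> Units R \<or> y \<in> Units R)"

lemma coeff_skew_mult:
  assumes "f 0 = 0"
  shows "coeff (skew_mult f A B) n = (\<Sum>i\<le>n. coeff A i * (f ^^ i) (coeff B (n - i)))"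
proof -
  have f0: "(f ^^ i) 0 = 0" for i
    by (induction i) (auto simp: assms)
  have "coeff (skew_mult f A B) n =
      (\<Sum>i\<le>degree A. \<Sum>j\<le>degree B.
         if i + j = n then coeff A i * (f ^^ i) (coeff B j) else 0)"
    by (simp add: skew_mult_def coeff_sum)
  also have "\<dots> = (\<Sum>i\<le>degree A. if i \<le> n then coeff A i * (f ^^ i) (coeff B (n - i)) else 0)"
  proof (rule sum.cong[OF refl])
    fix i
    have "(\<Sum>j\<le>degree B. if i + j = n then coeff A i * (f ^^ i) (coeff B j) else 0) =
        (\<Sum>j\<le>degree B. if j = n - i then (if i \<le> n then coeff A i * (f ^^ i) (coeff B j) else 0) else 0)"
      by (rule sum.cong) auto
    also have "\<dots> = (if i \<le> n then coeff A i * (f ^^ i) (coeff B (n - i)) else 0)"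
      by (auto simp: sum.delta coeff_eq_0 f0)
    finally show "(\<Sum>j\<le>degree B. if i + j = n then coeff A i * (f ^^ i) (coeff B j) else 0) =
        (if i \<le> n then coeff A i * (f ^^ i) (coeff B (n - i)) else 0)" .
  qed
  also have "\<dots> = (\<Sum>i\<le>n. coeff A i * (f ^^ i) (coeff B (n - i)))"
    by (rule sum.mono_neutral_cong) (auto simp: coeff_eq_0)
  finally show ?thesis .
qed

lemma ring_skew_poly_ring:
  assumes "\<And>x y. f (x + y) = f x + f y" "\<And>x y. f (x * y) = f x * f y" "f 1 = 1"
  shows "ring (skew_poly_ring f)"
proof -
  have "f 0 = 0"
    using assms(1)[of 0 0] by simp
  note c = coeff_skew_mult[of f, OF this]
  have f0: "(f ^^ i) 0 = 0" and f1: "(f ^^ i) 1 = 1"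
    and fadd: "(f ^^ i) (x + y) = (f ^^ i) x + (f ^^ i) y"
    and fmul: "(f ^^ i) (x * y) = (f ^^ i) x * (f ^^ i) y" for i x y
    by (induction i) (auto simp: assms \<open>f 0 = 0\<close>)
  have fsum: "(f ^^ i) (sum g S) = (\<Sum>s\<in>S. (f ^^ i) (g s))" for i S and g :: "nat \<Rightarrow> 'a"
    by (induction S rule: infinite_finite_induct) (auto simp: f0 fadd)
  have assoc: "skew_mult f (skew_mult f A B) C = skew_mult f A (skew_mult f B C)" for A B C
  proof (rule poly_eqI)
    fix n
    have "coeff (skew_mult f (skew_mult f A B) C) n =
        (\<Sum>j\<le>n. \<Sum>i\<le>j. coeff A i * (f ^^ i) (coeff B (j - i)) *
            (f ^^ (i + (j - i))) (coeff C (n - j)))"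
      by (simp add: c sum_distrib_right)
    also have "\<dots> = (\<Sum>j\<le>n. \<Sum>i\<le>n - j. coeff A j * (f ^^ j) (coeff B i) *
            (f ^^ (j + i)) (coeff C (n - j - i)))"
      using fps_mult_assoc_lemma[where k = n and f = "\<lambda>i m r. coeff A i * (f ^^ i) (coeff B m) *
            (f ^^ (i + m)) (coeff C r)"] by (simp add: atLeast0AtMost)
    also have "\<dots> = coeff (skew_mult f A (skew_mult f B C)) n"
      by (simp add: c fsum fmul sum_distrib_left funpow_add mult.assoc)
    finally show "coeff (skew_mult f (skew_mult f A B) C) n =
        coeff (skew_mult f A (skew_mult f B C)) n" .
  qed
  have one_l: "skew_mult f 1 A = A" for A
    by (rule poly_eqI) (simp add: c lead_coeff_1 if_distrib[of "\<lambda>x. x * _"] sum.delta cong: if_cong)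
  have one_r: "skew_mult f A 1 = A" for A
  proof (rule poly_eqI)
    fix n
    have "coeff (skew_mult f A 1) n = (\<Sum>i\<le>n. if i = n then coeff A i else 0)"
      unfolding c by (rule sum.cong) (auto simp: f0 f1)
    then show "coeff (skew_mult f A 1) n = coeff A n" by simp
  qed
  have dl: "skew_mult f (A + B) C = skew_mult f A C + skew_mult f B C"
    and dr: "skew_mult f C (A + B) = skew_mult f C A + skew_mult f C B" for A B C
    by (rule poly_eqI, simp add: c fadd algebra_simps sum.distrib)+
  have neg: "\<exists>B. A + B = 0" for A :: "'a poly"
    by (rule exI[of _ "- A"]) simp
  show ?thesis
  proof (rule ringI)
    show "abelian_group (skew_poly_ring f)"
      by (rule abelian_groupI) (simp_all add: skew_poly_ring_def add_ac neg)
    show "Group.monoid (skew_poly_ring f)"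
      by (rule Group.monoidI) (simp_all add: skew_poly_ring_def assoc one_l one_r)
  qed (simp_all add: skew_poly_ring_def dl dr)
qed

section \<open>The Newton polygon\<close>

definition newton_region :: "nat \<Rightarrow> 'k::zero fls poly \<Rightarrow> (real \<times> real) set" where
  "newton_region b A = convex hull
     {(real b ^ i, y) | i y. coeff A i \<noteq> 0 \<and> real_of_int (fls_subdegree (coeff A i)) \<le> y}"

definition newton_polygon :: "nat \<Rightarrow> 'k::zero fls poly \<Rightarrow> (real \<times> real) set" where
  "newton_polygon b A =
     {(x, y). (x, y) \<in> newton_region b A \<and> (\<forall>y'. (x, y') \<in> newton_region b A \<longrightarrow> y \<le> y')}"

definition newton_slopes :: "nat \<Rightarrow> 'k::zero fls poly \<Rightarrow> real set" where
  "newton_slopes b A = {(snd Q - snd P) / (fst Q - fst P) | P Q.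
     fst P < fst Q \<and> closed_segment P Q \<subseteq> newton_polygon b A}"

definition monoclinic_of_slope :: "nat \<Rightarrow> 'k::zero fls poly \<Rightarrow> rat \<Rightarrow> bool" where
  "monoclinic_of_slope b A \<mu> \<longleftrightarrow> newton_slopes b A = {of_rat \<mu>}"

section \<open>Fractional powers of the uniformizer and the reduction along a slope\<close>

text \<open>A series in fractional powers of \<open>u\<close> is represented by its coefficient function on the
  rational exponents.  Below, one factor of a product is always a monomial, so that the sum
  defining the Cauchy product has at most one term.\<close>

type_synonym 'k frac_series = "rat \<Rightarrow> 'k"

definition frac_of_fls :: "'k::zero fls \<Rightarrow> 'k frac_series" where
  "frac_of_fls f = (\<lambda>q. if q \<in> \<int> then fls_nth f \<lfloor>q\<rfloor> else 0)"

definition u_pow :: "rat \<Rightarrow> 'k::zero_neq_one frac_series" where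
  "u_pow r = (\<lambda>q. if q = r then 1 else 0)"

definition frac_mult :: "'k::comm_ring_1 frac_series \<Rightarrow> 'k frac_series \<Rightarrow> 'k frac_series" where
  "frac_mult f g = (\<lambda>q. \<Sum>r | f r \<noteq> 0 \<and> g (q - r) \<noteq> 0. f r * g (q - r))"

definition frac_phi :: "('k \<Rightarrow> 'k) \<Rightarrow> nat \<Rightarrow> 'k frac_series \<Rightarrow> 'k frac_series" where
  "frac_phi \<sigma> b f = (\<lambda>q. \<sigma> (f (q / of_nat b)))"

definition frac_has_val :: "'k::zero frac_series \<Rightarrow> rat \<Rightarrow> bool" where
  "frac_has_val f m \<longleftrightarrow> f m \<noteq> 0 \<and> (\<forall>q. f q \<noteq> 0 \<longrightarrow> m \<le> q)"

text \<open>Skew polynomials over the fractional series are given by their sequences of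
  coefficients; their valuation is the minimum of the valuations of the coefficients.\<close>

definition skew_has_val :: "(nat \<Rightarrow> 'k::zero frac_series) \<Rightarrow> rat \<Rightarrow> bool" where
  "skew_has_val B m \<longleftrightarrow>
     (\<exists>i. frac_has_val (B i) m) \<and> (\<forall>i q. frac_has_val (B i) q \<longrightarrow> m \<le> q)"

text \<open>The coefficients of \<open>u\<^sup>\<nu> A u\<^sup>-\<^sup>\<mu>\<close>: since \<open>T\<^sup>i c = \<phi>\<^sup>i(c) T\<^sup>i\<close>, that of \<open>T\<^sup>i\<close> is
  \<open>u\<^sup>\<nu> a\<^sub>i \<phi>\<^sup>i(u\<^sup>-\<^sup>\<mu>)\<close>.\<close>

definition conj_coeff ::
    "('k \<Rightarrow> 'k) \<Rightarrow> nat \<Rightarrow> rat \<Rightarrow> rat \<Rightarrow> 'k::field fls poly \<Rightarrow> nat \<Rightarrow> 'k frac_series" where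
  "conj_coeff \<sigma> b \<nu> \<mu> A i =
     frac_mult (u_pow \<nu>)
       (frac_mult (frac_of_fls (coeff A i)) ((frac_phi \<sigma> b ^^ i) (u_pow (- \<mu>))))"

lemma frac_mult_u_pow_left: "frac_mult (u_pow r) f q = f (q - r)"
proof -
  have "frac_mult (u_pow r) f q =
      (\<Sum>x\<in>{x. (u_pow r x :: 'a) \<noteq> 0 \<and> f (q - x) \<noteq> 0}. if x = r then f (q - r) else 0)"
    unfolding frac_mult_def by (rule sum.cong) (auto simp: u_pow_def)
  also have "\<dots> = (\<Sum>x\<in>{r}. if x = r then f (q - r) else 0)"
    by (rule sum.mono_neutral_cong_left) (auto simp: u_pow_def split: if_splits)
  finally show ?thesis by simp
qed

lemma frac_mult_u_pow_right: "frac_mult f (u_pow r) q = f (q - r)"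
proof -
  have "frac_mult f (u_pow r) q =
      (\<Sum>x\<in>{x. f x \<noteq> 0 \<and> (u_pow r (q - x) :: 'a) \<noteq> 0}. if x = q - r then f (q - r) else 0)"
    unfolding frac_mult_def by (rule sum.cong) (auto simp: u_pow_def)
  also have "\<dots> = (\<Sum>x\<in>{q - r}. if x = q - r then f (q - r) else 0)"
    by (rule sum.mono_neutral_cong_left) (auto simp: u_pow_def split: if_splits)
  finally show ?thesis by simp
qed

lemma frac_phi_u_pow:
  assumes "\<sigma> 0 = 0" "\<sigma> 1 = 1" "b > 0"
  shows "(frac_phi \<sigma> b ^^ i) (u_pow r) = u_pow (of_nat b ^ i * r)"
  by (induction i) (use assms in \<open>auto simp: frac_phi_def u_pow_def fun_eq_iff field_simps\<close>)

lemma conj_coeff_eq: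
  assumes "\<sigma> 0 = 0" "\<sigma> 1 = 1" "b > 0"
  shows "conj_coeff \<sigma> b \<nu> \<mu> A i q = frac_of_fls (coeff A i) (q - \<nu> + of_nat b ^ i * \<mu>)"
  by (simp add: conj_coeff_def frac_mult_u_pow_left frac_mult_u_pow_right
      frac_phi_u_pow[OF assms])

definition reduction_exponent :: "('k \<Rightarrow> 'k) \<Rightarrow> nat \<Rightarrow> rat \<Rightarrow> 'k::field fls poly \<Rightarrow> rat" where
  "reduction_exponent \<sigma> b \<mu> A = (THE \<nu>. skew_has_val (conj_coeff \<sigma> b \<nu> \<mu> A) 0)"

text \<open>Reduction modulo positive valuation keeps the coefficient of \<open>u\<^sup>0\<close>.\<close>

definition slope_reduction :: "('k \<Rightarrow> 'k) \<Rightarrow> nat \<Rightarrow> rat \<Rightarrow> 'k::field fls poly \<Rightarrow> 'k poly" where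
  "slope_reduction \<sigma> b \<mu> A =
     (\<Sum>i\<le>degree A. monom (conj_coeff \<sigma> b (reduction_exponent \<sigma> b \<mu> A) \<mu> A i 0) i)"

section \<open>The length of a slope\<close>

text \<open>The exponent \<open>\<alpha>\<close> is not unique when \<open>b\<close> is composite or \<open>\<mu> = 0\<close>, but \<open>\<bar>t\<bar>\<close> is.
  A denominator \<open>t = -1\<close> counts as \<open>t = 1\<close>.\<close>

definition b_length :: "nat \<Rightarrow> rat \<Rightarrow> nat" where
  "b_length b \<mu> = (THE l. \<exists>\<alpha> s t :: int.
     t \<noteq> 0 \<and> coprime s t \<and> coprime t (int b) \<and>
     \<mu> = of_nat b powi \<alpha> * (of_int s / of_int t) \<and>
     l = (if \<bar>t\<bar> = 1 then 0 else ord (nat \<bar>t\<bar>) b))"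

end

theory Submission
  imports Defs
begin

text \<open>Let \<open>\<mu> = s / t\<close> be the first slope of \<open>A\<close>. Adjoining \<open>w = u\<^sup>1\<^sup>/\<^sup>t\<close> and conjugating by \<open>w\<^sup>s\<close>
  moves \<open>\<mu>\<close> to \<open>0\<close>, and \<open>K[T,\<phi>]\<close> becomes the subring cut out by a congruence modulo \<open>t\<close> on the
  exponents of \<open>w\<close>, which at level \<open>0\<close> selects the powers of \<open>T\<^sup>\<ell>\<close>. Because \<open>\<phi>\<close> multiplies positive
  valuations by \<open>b \<ge> 2\<close>, the linearised equation for lifting a factorization \<open>B\<^sub>0 C\<^sub>0\<close> of the reduction
  involves a correction of \<open>C\<^sub>0\<close> only through the constant term of \<open>B\<^sub>0\<close>. If that term is
  nonzero, division with remainder by \<open>C\<^sub>0\<close> solves it, so the factorization lifts without any coprimality hypothesis. Lifting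
  \<open>1 \<cdot> C\<^sub>0\<close> shows that an irreducible \<open>A\<close> is monoclinic, and lifting arbitrary factorizations shows that
  its reduction is irreducible. Conversely, reductions are multiplicative by Gauss's lemma.\<close>

section \<open>Skew polynomials over a field\<close>

text \<open>Instantiated twice, with \<open>\<sigma>\<close> on the residue field and with
  \<open>phi \<sigma> b\<close> on the Laurent series, so that skew arithmetic is developed
  once.\<close>

locale field_endomorphism =
  fixes f :: "'a::field \<Rightarrow> 'a"
  assumes f_add: "f (x + y) = f x + f y"
    and f_mult: "f (x * y) = f x * f y"
    and f_1: "f 1 = 1"
begin

lemma f_0: "f 0 = 0"
  using f_add[of 0 0] by (metis add_0_right add_left_imp_eq)

lemma f_eq_0_iff: "f x = 0 \<longleftrightarrow> x = 0"
  using f_mult[of x "inverse x"] f_1 f_0 by (cases "x = 0") auto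

lemma funpow_add: "(f ^^ i) (x + y) = (f ^^ i) x + (f ^^ i) y"
  by (induction i) (auto simp: f_add)

lemma funpow_mult: "(f ^^ i) (x * y) = (f ^^ i) x * (f ^^ i) y"
  by (induction i) (auto simp: f_mult)

lemma funpow_0 [simp]: "(f ^^ i) 0 = 0"
  by (induction i) (auto simp: f_0)

lemma funpow_1 [simp]: "(f ^^ i) 1 = 1"
  by (induction i) (auto simp: f_1)

lemma funpow_eq_0_iff [simp]: "(f ^^ i) x = 0 \<longleftrightarrow> x = 0"
  by (induction i) (auto simp: f_eq_0_iff)

lemma funpow_sum: "(f ^^ i) (sum g S) = (\<Sum>s\<in>S. (f ^^ i) (g s))"
  by (induction S rule: infinite_finite_induct) (auto simp: funpow_add)

lemma f_sum: "f (sum g S) = (\<Sum>s\<in>S. f (g s))"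
  using funpow_sum[of 1] by simp

lemmas coeff_mult = coeff_skew_mult[of f, OF f_0]

lemma skew_ring: "ring (skew_poly_ring f)"
  by (rule ring_skew_poly_ring) (auto simp: f_add f_mult f_1)

lemma mult_assoc: "skew_mult f (skew_mult f A B) C = skew_mult f A (skew_mult f B C)"
  using ring.ring_simprules(11)[OF skew_ring, of A B C] by (simp add: skew_poly_ring_def)

lemma mult_one_left [simp]: "skew_mult f 1 A = A"
  using ring.ring_simprules(12)[OF skew_ring, of A] by (simp add: skew_poly_ring_def)

lemma mult_zero_left [simp]: "skew_mult f 0 A = 0"
  by (rule poly_eqI) (simp add: coeff_mult)

lemma mult_zero_right [simp]: "skew_mult f A 0 = 0"
  by (rule poly_eqI) (simp add: coeff_mult)

lemma mult_add_left: "skew_mult f (A + B) C = skew_mult f A C + skew_mult f B C"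
  by (rule poly_eqI) (simp add: coeff_mult algebra_simps sum.distrib)

lemma smult_mult: "skew_mult f (Polynomial.smult c A) B = Polynomial.smult c (skew_mult f A B)"
  by (rule poly_eqI) (simp add: coeff_mult sum_distrib_left mult_ac)

lemma const_mult: "skew_mult f [:c:] A = Polynomial.smult c A"
  using smult_mult[of c 1 A] by (simp add: smult_one)

lemma coeff_mult_const: "coeff (skew_mult f A [:c:]) n = coeff A n * (f ^^ n) c"
proof -
  have "coeff (skew_mult f A [:c:]) n = (\<Sum>i\<le>n. if i = n then coeff A n * (f ^^ n) c else 0)"
    unfolding coeff_mult by (rule sum.cong) (auto simp: coeff_pCons split: nat.split)
  then show ?thesis by simp
qed

lemma coeff_monom_mult:
  "coeff (skew_mult f (monom c m) A) n = (if m \<le> n then c * (f ^^ m) (coeff A (n - m)) else 0)"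
proof -
  have "coeff (skew_mult f (monom c m) A) n =
      (\<Sum>i\<le>n. if i = m then c * (f ^^ m) (coeff A (n - m)) else 0)"
    unfolding coeff_mult by (rule sum.cong) auto
  then show ?thesis by simp
qed

lemma coeff_mult_monom_1:
  "coeff (skew_mult f A (monom 1 m)) n = (if m \<le> n then coeff A (n - m) else 0)"
proof -
  have "coeff (skew_mult f A (monom 1 m)) n =
      (\<Sum>i\<le>n. if i = n - m then (if m \<le> n then coeff A (n - m) else 0) else 0)"
    unfolding coeff_mult by (rule sum.cong) auto
  then show ?thesis by simp
qed

lemma coeff_0_mult: "coeff (skew_mult f A B) 0 = coeff A 0 * coeff B 0"
  by (simp add: coeff_mult)

lemma degree_mult_le: "degree (skew_mult f A B) \<le> degree A + degree B"
proof (rule degree_le, intro allI impI)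
  fix n assume n: "degree A + degree B < n"
  show "coeff (skew_mult f A B) n = 0"
    unfolding coeff_mult
  proof (rule sum.neutral, rule ballI)
    fix i assume "i \<in> {..n}"
    then have "degree A < i \<or> degree B < n - i" using n by auto
    then show "coeff A i * (f ^^ i) (coeff B (n - i)) = 0" by (auto simp: coeff_eq_0)
  qed
qed

lemma coeff_mult_degree_sum:
  "coeff (skew_mult f A B) (degree A + degree B) =
     lead_coeff A * (f ^^ degree A) (lead_coeff B)"
proof -
  have "coeff (skew_mult f A B) (degree A + degree B) =
      (\<Sum>i\<le>degree A + degree B. if i = degree A
         then lead_coeff A * (f ^^ degree A) (lead_coeff B) else 0)"
    unfolding coeff_mult
  proof (rule sum.cong[OF refl])
    fix i
    show "coeff A i * (f ^^ i) (coeff B (degree A + degree B - i)) =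
        (if i = degree A then lead_coeff A * (f ^^ degree A) (lead_coeff B) else 0)"
      by (cases i "degree A" rule: linorder_cases) (auto simp: coeff_eq_0)
  qed
  then show ?thesis by simp
qed

text \<open>The top coefficient of a product is
  \<open>lead_coeff A * (f ^^ degree A) (lead_coeff B)\<close>, and injectivity of \<open>f\<close>
  keeps it nonzero.\<close>

lemma mult_eq_0_iff: "skew_mult f A B = 0 \<longleftrightarrow> A = 0 \<or> B = 0"
proof
  assume "skew_mult f A B = 0"
  then have "lead_coeff A * (f ^^ degree A) (lead_coeff B) = 0"
    by (simp flip: coeff_mult_degree_sum)
  then show "A = 0 \<or> B = 0" by simp
qed auto

lemma degree_mult:
  assumes "A \<noteq> 0" "B \<noteq> 0"
  shows "degree (skew_mult f A B) = degree A + degree B"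
proof (rule antisym[OF degree_mult_le])
  have "coeff (skew_mult f A B) (degree A + degree B) \<noteq> 0"
    using assms by (simp add: coeff_mult_degree_sum)
  then show "degree A + degree B \<le> degree (skew_mult f A B)" by (rule le_degree)
qed

text \<open>Only \<open>E - Q C\<close> with quotient \<open>Q\<close> on the left is possible, since \<open>f\<close> need not be surjective.\<close>

lemma division:
  assumes "C \<noteq> 0" "degree C > 0"
    and C: "\<And>i. coeff C i \<noteq> 0 \<Longrightarrow> l dvd i"
    and S: "\<And>i j. l dvd j \<Longrightarrow> i + j \<in> S \<longleftrightarrow> i \<in> S"
    and "\<And>i. coeff E i \<noteq> 0 \<Longrightarrow> i \<in> S"
  shows "\<exists>Q R. E = skew_mult f Q C + R \<and> degree R < degree C \<and> degree Q \<le> degree E - degree C \<and>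
           (\<forall>i. coeff Q i \<noteq> 0 \<longrightarrow> i \<in> S) \<and> (\<forall>i. coeff R i \<noteq> 0 \<longrightarrow> i \<in> S)"
  using assms(5)
proof (induction "degree E" arbitrary: E rule: less_induct)
  case less
  define c where "c = degree C"
  define e where "e = degree E"
  have lc: "lead_coeff C \<noteq> 0" "l dvd c"
    using assms C by (auto simp: c_def)
  show ?case
  proof (cases "e < c")
    case True
    then show ?thesis
      using less.prems by (intro exI[of _ 0] exI[of _ E]) (auto simp: c_def e_def)
  next
    case False
    then have e: "c \<le> e" "e > 0" using assms(2) by (auto simp: c_def)
    \<comment> \<open>Moving \<open>T^(e-c)\<close> past the leading coefficient of \<open>C\<close>
      applies \<open>f ^^ (e - c)\<close> to it, so with this coefficient \<open>M C\<close> cancels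
      the leading term of \<open>E\<close>.\<close>
    define q where "q = lead_coeff E / (f ^^ (e - c)) (lead_coeff C)"
    define M where "M = monom q (e - c)"
    define E' where "E' = E - skew_mult f M C"
    \<comment> \<open>The quotient term sits at \<open>e - c\<close>; since \<open>l\<close> divides
      \<open>c\<close>, membership in \<open>S\<close> passes from \<open>e\<close> to
      \<open>e - c\<close>.\<close>
    have eS: "e \<in> S" using less.prems[of e] e by (cases "E = 0") (auto simp: e_def)
    have ecS: "e - c \<in> S" using S[OF lc(2), of "e - c"] eS e by simp
    have E'S: "i \<in> S" if "coeff E' i \<noteq> 0" for i
    proof (cases "coeff E i = 0")
      case True
      then have "e - c \<le> i" "coeff C (i - (e - c)) \<noteq> 0"
        using that by (auto simp: E'_def M_def coeff_monom_mult split: if_splits)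
      then show ?thesis using S[OF C, of "i - (e - c)" "e - c"] ecS by simp
    next
      case False
      then show ?thesis by (rule less.prems)
    qed
    have "coeff E' i = 0" if "i \<ge> e" for i
    proof (cases "i = e")
      case True
      then show ?thesis using e lc
        by (simp add: E'_def M_def coeff_monom_mult q_def e_def c_def)
    next
      case False
      then have "degree E < i" "degree C < i - (e - c)" using that e by (auto simp: e_def c_def)
      then show ?thesis by (simp add: E'_def M_def coeff_monom_mult coeff_eq_0)
    qed
    then have "degree E' < e"
      using e(2) leading_coeff_0_iff[of E'] by (cases "e \<le> degree E'") auto
    then obtain Q R where QR: "E' = skew_mult f Q C + R" "degree R < c"
        "degree Q \<le> degree E' - c"
        "\<forall>i. coeff Q i \<noteq> 0 \<longrightarrow> i \<in> S" "\<forall>i. coeff R i \<noteq> 0 \<longrightarrow> i \<in> S"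
      using less.hyps[OF \<open>degree E' < e\<close>[unfolded e_def] E'S] unfolding e_def c_def by blast
    show ?thesis
    proof (intro exI conjI)
      show "E = skew_mult f (M + Q) C + R"
        using QR(1) by (simp add: E'_def mult_add_left algebra_simps)
      show "degree R < degree C" using QR by (simp add: c_def)
      have "degree M \<le> e - c" by (simp add: M_def degree_monom_le)
      moreover have "degree Q \<le> e - c" using QR(3) \<open>degree E' < e\<close> by simp
      ultimately show "degree (M + Q) \<le> degree E - degree C"
        unfolding c_def e_def by (rule degree_add_le)
      show "\<forall>i. coeff (M + Q) i \<noteq> 0 \<longrightarrow> i \<in> S"
        using QR(4) ecS by (auto simp: M_def split: if_splits)
    qed (use QR in auto)
  qed
qed

section \<open>Units and irreducible elements of skew polynomial rings\<close>

lemma Units_skew_power_subring: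
  "A \<in> Units (skew_power_subring f l) \<longleftrightarrow> A \<noteq> 0 \<and> degree A = 0"
proof
  assume "A \<in> Units (skew_power_subring f l)"
  then obtain B where "skew_mult f A B = 1"
    by (auto simp: Units_def skew_power_subring_def skew_poly_ring_def)
  then have "A \<noteq> 0" "B \<noteq> 0" "degree (skew_mult f A B) = 0"
    by auto
  then show "A \<noteq> 0 \<and> degree A = 0" using degree_mult[of A B] by simp
next
  assume "A \<noteq> 0 \<and> degree A = 0"
  then obtain c where c: "A = [:c:]" "c \<noteq> 0" by (metis degree_eq_zeroE pCons_eq_0_iff)
  then have "skew_mult f A [:inverse c:] = 1" "skew_mult f [:inverse c:] A = 1"
    by (simp_all add: const_mult one_pCons)
  then show "A \<in> Units (skew_power_subring f l)"
    using c by (auto simp: Units_def skew_power_subring_def skew_poly_ring_def coeff_pCons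
        split: nat.splits intro!: exI[of _ "[:inverse c:]"])
qed

text \<open>\<open>degree A > 0\<close> encodes nonzero and not a unit at once. Once
  \<open>A\<close> is nonzero no factor can vanish, so \<open>degree B = 0\<close> does express that
  \<open>B\<close> is a unit although \<open>degree 0 = 0\<close>.\<close>

lemma ring_irred_power_subring_iff:
  "ring_irred (skew_power_subring f l) A \<longleftrightarrow>
     (\<forall>i. coeff A i \<noteq> 0 \<longrightarrow> l dvd i) \<and> degree A > 0 \<and>
     (\<forall>B C. (\<forall>i. coeff B i \<noteq> 0 \<longrightarrow> l dvd i) \<longrightarrow> (\<forall>i. coeff C i \<noteq> 0 \<longrightarrow> l dvd i) \<longrightarrow>
        A = skew_mult f B C \<longrightarrow> degree B = 0 \<or> degree C = 0)"
proof -
  let ?P = "\<lambda>B. \<forall>i. coeff B i \<noteq> 0 \<longrightarrow> l dvd i"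
  have *: "(A \<noteq> 0 \<and> \<not> (A \<noteq> 0 \<and> degree A = 0)) \<longleftrightarrow> degree A > 0"
    by (cases "A = 0") auto
  have **: "(A = skew_mult f B C \<longrightarrow> B \<noteq> 0 \<and> degree B = 0 \<or> C \<noteq> 0 \<and> degree C = 0) \<longleftrightarrow>
      (A = skew_mult f B C \<longrightarrow> degree B = 0 \<or> degree C = 0)" if "degree A > 0" for B C
    using that mult_eq_0_iff[of B C] by (cases "B = 0"; cases "C = 0") auto
  have "ring_irred (skew_power_subring f l) A \<longleftrightarrow>
     ?P A \<and> (A \<noteq> 0 \<and> \<not> (A \<noteq> 0 \<and> degree A = 0)) \<and>
     (\<forall>B. ?P B \<longrightarrow> (\<forall>C. ?P C \<longrightarrow>
        A = skew_mult f B C \<longrightarrow> (B \<noteq> 0 \<and> degree B = 0 \<or> C \<noteq> 0 \<and> degree C = 0)))"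
    unfolding ring_irred_def Units_skew_power_subring
    by (simp only: skew_power_subring_def skew_poly_ring_def Ball_def
        ring.simps monoid.simps partial_object.simps mem_Collect_eq conj_assoc)
  then show ?thesis unfolding * by (simp only: ** all_simps(6) cong: conj_cong)
qed

lemma ring_irred_skew_iff:
  "ring_irred (skew_poly_ring f) A \<longleftrightarrow>
     degree A > 0 \<and> (\<forall>B C. A = skew_mult f B C \<longrightarrow> degree B = 0 \<or> degree C = 0)"
proof -
  have "skew_poly_ring f = skew_power_subring f 1"
    by (simp add: skew_power_subring_def skew_poly_ring_def)
  then show ?thesis by (simp add: ring_irred_power_subring_iff)
qed

text \<open>\<open>T^m\<close> splits off on the right, and \<open>l\<close> divides
  \<open>m\<close>, so the cofactor stays in the subring; irreducibility leaves it constant. This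
  later excludes a Newton polygon that starts at a positive index.\<close>

lemma degree_eq_lowest_if_irred:
  assumes "ring_irred (skew_power_subring f l) A" "m > 0" "coeff A m \<noteq> 0"
    and low: "\<And>i. i < m \<Longrightarrow> coeff A i = 0"
  shows "degree A = m"
proof -
  note irr = assms(1)[unfolded ring_irred_power_subring_iff]
  have lm: "l dvd m" using irr assms(3) by blast
  define B where "B = poly_shift m A"
  have A: "A = skew_mult f B (monom 1 m)"
    by (rule poly_eqI) (auto simp: coeff_mult_monom_1 B_def coeff_poly_shift low)
  have "A \<noteq> 0" using assms(3) by auto
  then have "B \<noteq> 0" using A by auto
  have deg: "degree A = degree B + m"
    using A degree_mult[OF \<open>B \<noteq> 0\<close>, of "monom 1 m"] by (simp add: degree_monom_eq monom_eq_0_iff)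
  have "l dvd i" if "coeff B i \<noteq> 0" for i
  proof -
    have "l dvd i + m" using irr that by (auto simp: B_def coeff_poly_shift)
    then show ?thesis using lm dvd_add_left_iff by blast
  qed
  moreover have "\<forall>i. coeff (monom (1::'a) m) i \<noteq> 0 \<longrightarrow> l dvd i" using lm by simp
  ultimately have "degree B = 0 \<or> degree (monom (1::'a) m) = 0"
    using irr[THEN conjunct2, THEN conjunct2, rule_format, of B "monom 1 m"] A by simp
  then show ?thesis using deg assms(2) by (simp add: degree_monom_eq)
qed

end

section \<open>Twisting by a slope\<close>

locale laurent_skew = k: field_endomorphism \<sigma> for \<sigma> :: "'k::field \<Rightarrow> 'k" +
  fixes b :: nat
  assumes b_ge_2: "b \<ge> 2"
begin

lemma b_pos: "b > 0"
  using b_ge_2 by simp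

lemmas nth_phi = fls_nth_phi[of \<sigma> b, OF k.f_0 b_pos]

lemma phi_shift: "phi \<sigma> b (fls_shift n f) = fls_shift (int b * n) (phi \<sigma> b f)"
  using b_pos by (intro fls_eqI) (auto simp: nth_phi algebra_simps)

lemma phi_fps_to_fls:
  "phi \<sigma> b (fps_to_fls f) = fls_compose_power (fps_to_fls (Abs_fps (\<lambda>n. \<sigma> (fps_nth f n)))) b"
  using b_pos by (intro fls_eqI) (auto simp: nth_phi fls_nth_compose_power k.f_0)

text \<open>Up to shifts the factors are power series, on which \<phi> is \<open>\<sigma>\<close> on
  the coefficients followed by the substitution of \<open>u^b\<close> for \<open>u\<close>; both are
  multiplicative.\<close>

lemma phi_mult: "phi \<sigma> b (f * g) = phi \<sigma> b f * phi \<sigma> b g"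
proof -
  obtain m f' where f: "f = fls_shift m (fps_to_fls f')"
    using fls_conv_base_factor_to_fps_shift_subdegree by blast
  obtain n g' where g: "g = fls_shift n (fps_to_fls g')"
    using fls_conv_base_factor_to_fps_shift_subdegree by blast
  let ?S = "\<lambda>h. Abs_fps (\<lambda>n. \<sigma> (fps_nth h n))"
  have "?S (f' * g') = ?S f' * ?S g'"
    by (rule fps_ext)
      (simp add: fps_mult_nth k.f_mult k.f_sum)
  then have "phi \<sigma> b (fps_to_fls (f' * g')) = phi \<sigma> b (fps_to_fls f') * phi \<sigma> b (fps_to_fls g')"
    unfolding phi_fps_to_fls by (simp only: fls_times_fps_to_fls fls_compose_power_mult)
  then have "phi \<sigma> b (fps_to_fls f' * fps_to_fls g') = phi \<sigma> b (fps_to_fls f') * phi \<sigma> b (fps_to_fls g')"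
    by (simp only: fls_times_fps_to_fls)
  then show ?thesis
    by (simp add: f g fls_shifted_times_simps phi_shift distrib_left add.commute)
qed

sublocale K: field_endomorphism "phi \<sigma> b"
proof
  show "phi \<sigma> b (x + y) = phi \<sigma> b x + phi \<sigma> b y" for x y
    by (intro fls_eqI) (auto simp: nth_phi k.f_add)
  show "phi \<sigma> b 1 = 1"
    using b_pos by (intro fls_eqI) (auto simp: nth_phi k.f_0 k.f_1 elim!: dvdE)
qed (rule phi_mult)

lemma nth_funpow_phi:
  "fls_nth ((phi \<sigma> b ^^ i) f) n =
     (if int b ^ i dvd n then (\<sigma> ^^ i) (fls_nth f (n div int b ^ i)) else 0)"
proof (induction i arbitrary: n)
  case (Suc i)
  have "int b * int b ^ i dvd n \<longleftrightarrow> int b dvd n \<and> int b ^ i dvd n div int b"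
    using b_pos by (auto elim!: dvdE)
  moreover have "n div int b div int b ^ i = n div (int b * int b ^ i)"
    by (simp add: zdiv_zmult2_eq)
  ultimately show ?case
    by (simp add: nth_phi Suc k.f_0)
qed auto

lemma funpow_phi_shift:
  "(phi \<sigma> b ^^ i) (fls_shift n f) = fls_shift (int b ^ i * n) ((phi \<sigma> b ^^ i) f)"
  by (induction i) (auto simp: phi_shift mult_ac)

text \<open>Substituting \<open>w^t\<close> for \<open>u\<close> commutes with \<phi>, which
  therefore acts on series in \<open>w\<close> by the same formula.\<close>

lemma funpow_phi_compose_power:
  assumes "t > 0"
  shows "(phi \<sigma> b ^^ i) (fls_compose_power f t) = fls_compose_power ((phi \<sigma> b ^^ i) f) t"
proof (induction i)
  case (Suc i)
  have "phi \<sigma> b (fls_compose_power g t) = fls_compose_power (phi \<sigma> b g) t" for g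
  proof (intro fls_eqI)
    fix n
    have "int b dvd n \<and> int t dvd n div int b \<longleftrightarrow> int b * int t dvd n"
      "int t dvd n \<and> int b dvd n div int t \<longleftrightarrow> int b * int t dvd n"
      using b_pos assms by (auto elim!: dvdE)
    moreover have "n div int b div int t = n div int t div int b"
      using zdiv_zmult2_eq[of "int t" n "int b"] zdiv_zmult2_eq[of "int b" n "int t"]
      by (simp add: mult.commute)
    ultimately show "fls_nth (phi \<sigma> b (fls_compose_power g t)) n =
        fls_nth (fls_compose_power (phi \<sigma> b g) t) n"
      using assms by (auto simp: nth_phi fls_nth_compose_power k.f_0)
  qed
  then show ?case by (simp add: Suc)
qed auto

end

text \<open>With \<open>w\<^sup>t = u\<close>, the twist is conjugation by \<open>w\<^sup>s\<close> on skew polynomials over the series in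
  \<open>w\<close>; it moves the slope \<open>s / t\<close> to \<open>0\<close>.\<close>

locale slope_twist = laurent_skew \<sigma> b for \<sigma> :: "'k::field \<Rightarrow> 'k" and b +
  fixes s :: int and t :: nat
  assumes t_pos: "t > 0"
begin

text \<open>Since \<open>w^s T^i w^(-s) = w^(s - b^i s) T^i\<close>, conjugation lowers the
  exponents in the coefficient of \<open>T^i\<close> by this amount.\<close>

definition shift_exp :: "nat \<Rightarrow> int" where
  "shift_exp i = (int b ^ i - 1) * s"

definition twist_coeff :: "nat \<Rightarrow> 'k fls \<Rightarrow> 'k fls" where
  "twist_coeff i f = fls_shift (shift_exp i) (fls_compose_power f t)"

definition twist :: "'k fls poly \<Rightarrow> 'k fls poly" where
  "twist P = (\<Sum>i\<le>degree P. monom (twist_coeff i (coeff P i)) i)"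

text \<open>The congruence that characterises the image of \<open>twist\<close>: necessity is
  \<open>supported_twist\<close>, sufficiency is \<open>twist_surj\<close>.\<close>

definition supported :: "'k fls poly \<Rightarrow> bool" where
  "supported P \<longleftrightarrow> (\<forall>i n. fls_nth (coeff P i) n \<noteq> 0 \<longrightarrow> int t dvd n + shift_exp i)"

lemma shift_exp_0 [simp]: "shift_exp 0 = 0"
  by (simp add: shift_exp_def)

lemma shift_exp_add: "shift_exp (i + j) = shift_exp i + int b ^ i * shift_exp j"
  by (simp add: shift_exp_def algebra_simps power_add)

lemma nth_twist_coeff:
  "fls_nth (twist_coeff i f) n =
     (if int t dvd n + shift_exp i then fls_nth f ((n + shift_exp i) div int t) else 0)"
  by (simp add: twist_coeff_def fls_nth_compose_power t_pos)

lemma nth_eq_nth_twist_coeff: "fls_nth f m = fls_nth (twist_coeff i f) (int t * m - shift_exp i)"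
  using t_pos by (simp add: nth_twist_coeff)

lemma twist_coeff_0 [simp]: "twist_coeff i 0 = 0"
  by (simp add: twist_coeff_def)

lemma twist_coeff_add: "twist_coeff i (f + g) = twist_coeff i f + twist_coeff i g"
  by (simp add: twist_coeff_def)

lemma twist_coeff_sum: "twist_coeff i (sum g S) = (\<Sum>x\<in>S. twist_coeff i (g x))"
  by (induction S rule: infinite_finite_induct) (auto simp: twist_coeff_add)

text \<open>The cocycle rule \<open>shift_exp_add\<close> matches the way \<open>T^i\<close>
  multiplies exponents by \<open>b^i\<close>; this is what makes \<open>twist\<close>
  multiplicative.\<close>

lemma twist_coeff_mult:
  "twist_coeff (i + j) (f * (phi \<sigma> b ^^ i) g) = twist_coeff i f * (phi \<sigma> b ^^ i) (twist_coeff j g)"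
  by (simp add: twist_coeff_def funpow_phi_shift funpow_phi_compose_power t_pos
      fls_shifted_times_simps shift_exp_add algebra_simps)

lemma inj_twist_coeff: "twist_coeff i f = twist_coeff i g \<longleftrightarrow> f = g"
proof
  assume "twist_coeff i f = twist_coeff i g"
  then show "f = g" by (intro fls_eqI) (metis nth_eq_nth_twist_coeff)
qed simp

lemma twist_coeff_eq_0_iff [simp]: "twist_coeff i f = 0 \<longleftrightarrow> f = 0"
  using inj_twist_coeff[of i f 0] by simp

lemma coeff_twist [simp]: "coeff (twist P) i = twist_coeff i (coeff P i)"
proof -
  have "coeff (twist P) i = (\<Sum>j\<le>degree P. if j = i then twist_coeff i (coeff P i) else 0)"
    unfolding twist_def coeff_sum by (rule sum.cong) auto
  then show ?thesis by (auto simp: coeff_eq_0)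
qed

lemma degree_twist [simp]: "degree (twist P) = degree P"
proof (rule antisym)
  show "degree (twist P) \<le> degree P"
    by (rule degree_le) (simp add: coeff_eq_0)
  show "degree P \<le> degree (twist P)"
    by (rule degree_le) (use coeff_eq_0[of "twist P"] in auto)
qed

lemma twist_mult: "twist (skew_mult (phi \<sigma> b) A B) = skew_mult (phi \<sigma> b) (twist A) (twist B)"
proof (rule poly_eqI)
  fix n
  have "coeff (twist (skew_mult (phi \<sigma> b) A B)) n =
      (\<Sum>i\<le>n. twist_coeff (i + (n - i)) (coeff A i * (phi \<sigma> b ^^ i) (coeff B (n - i))))"
    by (simp add: K.coeff_mult twist_coeff_sum)
  also have "\<dots> = coeff (skew_mult (phi \<sigma> b) (twist A) (twist B)) n"
    by (simp only: twist_coeff_mult K.coeff_mult coeff_twist)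
  finally show "coeff (twist (skew_mult (phi \<sigma> b) A B)) n =
      coeff (skew_mult (phi \<sigma> b) (twist A) (twist B)) n" .
qed

lemma inj_twist: "twist A = twist B \<longleftrightarrow> A = B"
proof
  assume "twist A = twist B"
  then have "twist_coeff i (coeff A i) = twist_coeff i (coeff B i)" for i
    by (metis coeff_twist)
  then show "A = B" by (intro poly_eqI) (simp add: inj_twist_coeff)
qed simp

lemma supported_twist: "supported (twist P)"
  by (auto simp: supported_def nth_twist_coeff split: if_splits)

lemma supportedD: "supported P \<Longrightarrow> fls_nth (coeff P i) n \<noteq> 0 \<Longrightarrow> int t dvd n + shift_exp i"
  by (simp add: supported_def)

lemma twist_surj:
  assumes "supported P"
  shows "\<exists>Q. twist Q = P"
proof -
  have "\<exists>f. twist_coeff i f = coeff P i" for i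
  proof -
    define g where "g m = fls_nth (coeff P i) (int t * m - shift_exp i)" for m
    \<comment> \<open>\<open>Abs_fls g\<close> needs a lower bound for the support of
      \<open>g\<close>. For negative \<open>m\<close> one has \<open>t m \<le> m\<close>, so
      \<open>- \<bar>x\<bar>\<close> serves.\<close>
    define x where "x = fls_subdegree (coeff P i) + shift_exp i"
    have g0: "g m = 0" if "m < - \<bar>x\<bar>" for m
    proof -
      have "m < 0" "int t \<ge> 1" using that t_pos by auto
      then have "int t * m \<le> m" by (simp add: mult_le_cancel_right1)
      then have "int t * m - shift_exp i < fls_subdegree (coeff P i)"
        using that by (simp add: x_def)
      then show ?thesis by (simp add: g_def)
    qed
    have "fls_nth (Abs_fls g) m = g m" for m
      by (rule nth_Abs_fls_lower_bound[of "- \<bar>x\<bar>"]) (simp add: g0)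
    then have "twist_coeff i (Abs_fls g) = coeff P i"
      using assms by (intro fls_eqI) (auto simp: nth_twist_coeff g_def supported_def)
    then show ?thesis ..
  qed
  then obtain q where q: "\<And>i. twist_coeff i (q i) = coeff P i" by metis
  define Q where "Q = (\<Sum>i\<le>degree P. monom (q i) i)"
  have "coeff Q i = (if i \<le> degree P then q i else 0)" for i
  proof -
    have "coeff Q i = (\<Sum>j\<le>degree P. if j = i then q i else 0)"
      unfolding Q_def coeff_sum by (rule sum.cong) auto
    then show ?thesis by auto
  qed
  then have "twist Q = P" by (intro poly_eqI) (auto simp: q coeff_eq_0)
  then show ?thesis ..
qed

end

section \<open>Lifting factorizations of the reduction\<close>

definition integral_fls :: "'a::zero fls \<Rightarrow> bool" where
  "integral_fls f \<longleftrightarrow> (\<forall>n<0. fls_nth f n = 0)"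

text \<open>Reads a skew polynomial over Laurent series as a series in the uniformiser with
  polynomial coefficients; for integral input \<open>digit 0\<close> is the residue.\<close>

definition digit :: "int \<Rightarrow> 'a::zero fls poly \<Rightarrow> 'a poly" where
  "digit n P = map_poly (\<lambda>f. fls_nth f n) P"

lemma coeff_digit [simp]: "coeff (digit n P) i = fls_nth (coeff P i) n"
  by (simp add: digit_def coeff_map_poly)

lemma degree_digit_le: "degree (digit n P) \<le> degree P"
  by (rule degree_le) (simp add: coeff_eq_0)

lemma integral_fls_conv_fps:
  assumes "integral_fls f"
  shows "f = fps_to_fls (Abs_fps (\<lambda>n. fls_nth f (int n)))"
  using assms by (intro fls_eqI) (auto simp: integral_fls_def)

lemma integral_fls_times:
  fixes f g :: "'a::{comm_monoid_add, mult_zero} fls"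
  assumes "integral_fls f" "integral_fls g"
  shows "integral_fls (f * g)"
    and "fls_nth (f * g) (int n) = (\<Sum>i\<le>n. fls_nth f (int i) * fls_nth g (int (n - i)))"
proof -
  let ?F = "\<lambda>h. Abs_fps (\<lambda>n. fls_nth h (int n))"
  have fg: "f * g = fps_to_fls (?F f * ?F g)"
    by (simp only: fls_times_fps_to_fls integral_fls_conv_fps[OF assms(1), symmetric]
        integral_fls_conv_fps[OF assms(2), symmetric])
  show "integral_fls (f * g)"
    unfolding fg integral_fls_def by simp
  show "fls_nth (f * g) (int n) = (\<Sum>i\<le>n. fls_nth f (int i) * fls_nth g (int (n - i)))"
    unfolding fg by (simp add: fps_mult_nth atLeast0AtMost del: fls_times_fps_to_fls)
qed

lemma integral_fls_sum:
  "(\<And>x. x \<in> S \<Longrightarrow> integral_fls (g x)) \<Longrightarrow> integral_fls (\<Sum>x\<in>S. g x :: 'a::comm_monoid_add fls)"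
  by (induction S rule: infinite_finite_induct) (auto simp: integral_fls_def)

lemma fls_nth_sum: "fls_nth (\<Sum>x\<in>S. g x) n = (\<Sum>x\<in>S. fls_nth (g x :: 'a::comm_monoid_add fls) n)"
  by (induction S rule: infinite_finite_induct) auto

text \<open>Since \<open>T\<^sup>i\<close> multiplies the exponents to its right by \<open>b\<^sup>i\<close>, the top digit \<open>y n\<close> enters the
  \<open>n\<close>-th digit of a product only for \<open>i = 0\<close>.\<close>

lemma weighted_convolution_split:
  fixes x y :: "nat \<Rightarrow> 'a::comm_ring_1"
  assumes "n > 0" "b \<ge> (2::nat)"
  shows "(\<Sum>n1\<le>n. \<Sum>n2\<le>n. if n1 + b ^ i * n2 = n then x n1 * y n2 else 0) =
    (\<Sum>n1<n. \<Sum>n2<n. if n1 + b ^ i * n2 = n then x n1 * y n2 else 0)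
      + x n * y 0 + (if i = 0 then x 0 * y n else 0)"
proof -
  define G where "G n1 n2 = (if n1 + b ^ i * n2 = n then x n1 * y n2 else 0)" for n1 n2
  have b: "b ^ i > 0" "b ^ i \<ge> 1" "b ^ i = 1 \<longleftrightarrow> i = 0" using assms by auto
  \<comment> \<open>\<open>n2 = n\<close> forces \<open>n1 = 0\<close> and \<open>b^i = 1\<close>,
    and \<open>b \<ge> 2\<close> turns the latter into \<open>i = 0\<close>.\<close>
  have Gn: "G n1 n = (if n1 = 0 then (if i = 0 then x 0 * y n else 0) else 0)" for n1
  proof (cases "n1 + b ^ i * n = n")
    case True
    have "n \<le> b ^ i * n" using mult_le_mono1[OF b(2), of n] by simp
    then have "n1 = 0" "b ^ i * n = n" using True by linarith+
    then show ?thesis using b assms by (auto simp: G_def)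
  qed (auto simp: G_def)
  have nG: "G n n2 = (if n2 = 0 then x n * y 0 else 0)" for n2
    using b by (auto simp: G_def)
  have "(\<Sum>n1\<le>n. \<Sum>n2\<le>n. G n1 n2) = (\<Sum>n1<n. \<Sum>n2<n. G n1 n2) + (\<Sum>n1<n. G n1 n)
      + (\<Sum>n2<n. G n n2) + G n n"
    by (simp add: sum.lessThan_Suc sum.distrib algebra_simps flip: lessThan_Suc_atMost)
  also have "(\<Sum>n1<n. G n1 n) = (if i = 0 then x 0 * y n else 0)"
    unfolding Gn using assms(1) by simp
  also have "(\<Sum>n2<n. G n n2) = x n * y 0"
    unfolding nG using assms(1) by simp
  also have "G n n = 0" unfolding nG using assms(1) by simp
  finally show ?thesis by (simp add: G_def algebra_simps)
qed

context laurent_skew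
begin

lemma integral_funpow_phi:
  assumes "integral_fls f"
  shows "integral_fls ((phi \<sigma> b ^^ i) f)"
  unfolding integral_fls_def
proof (intro allI impI)
  fix n :: int assume "n < 0"
  then have "n div int b ^ i < 0" using b_pos by (simp add: div_neg_pos_less0)
  then show "fls_nth ((phi \<sigma> b ^^ i) f) n = 0"
    using assms by (simp add: nth_funpow_phi integral_fls_def)
qed

text \<open>\<open>w^n1 T^i w^n2\<close> equals \<open>w^(n1 + b^i n2) T^i\<close>; since
  \<open>b^i \<ge> 1\<close>, only indices up to \<open>n\<close> can produce exponent
  \<open>n\<close>.\<close>

lemma nth_skew_term:
  assumes "integral_fls f" "integral_fls g"
  shows "fls_nth (f * (phi \<sigma> b ^^ i) g) (int n) =
    (\<Sum>n1\<le>n. \<Sum>n2\<le>n. if n1 + b ^ i * n2 = n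
       then fls_nth f (int n1) * (\<sigma> ^^ i) (fls_nth g (int n2)) else 0)"
proof -
  have "fls_nth (f * (phi \<sigma> b ^^ i) g) (int n) =
      (\<Sum>n1\<le>n. fls_nth f (int n1) * fls_nth ((phi \<sigma> b ^^ i) g) (int (n - n1)))"
    by (intro integral_fls_times integral_funpow_phi assms)
  also have "\<dots> = (\<Sum>n1\<le>n. \<Sum>n2\<le>n. if n1 + b ^ i * n2 = n
       then fls_nth f (int n1) * (\<sigma> ^^ i) (fls_nth g (int n2)) else 0)"
  proof (rule sum.cong[OF refl])
    fix n1 assume "n1 \<in> {..n}"
    then have n1: "n1 \<le> n" by simp
    have bi: "b ^ i > 0" using b_pos by simp
    have eq: "n1 + b ^ i * n2 = n \<longleftrightarrow> b ^ i dvd (n - n1) \<and> n2 = (n - n1) div b ^ i" for n2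
      using n1 bi by (auto elim!: dvdE)
    have le: "(n - n1) div b ^ i \<le> n" by (meson div_le_dividend diff_le_self le_trans)
    have "fls_nth ((phi \<sigma> b ^^ i) g) (int (n - n1)) =
        (if b ^ i dvd (n - n1) then (\<sigma> ^^ i) (fls_nth g (int ((n - n1) div b ^ i))) else 0)"
      unfolding nth_funpow_phi by (simp flip: of_nat_power add: zdiv_int)
    moreover have "(\<Sum>n2\<le>n. if n1 + b ^ i * n2 = n
          then fls_nth f (int n1) * (\<sigma> ^^ i) (fls_nth g (int n2)) else 0) =
        (\<Sum>n2\<le>n. if n2 = (n - n1) div b ^ i then (if b ^ i dvd (n - n1)
          then fls_nth f (int n1) * (\<sigma> ^^ i) (fls_nth g (int n2)) else 0) else 0)"
      unfolding eq by (rule sum.cong) auto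
    ultimately show "fls_nth f (int n1) * fls_nth ((phi \<sigma> b ^^ i) g) (int (n - n1)) =
        (\<Sum>n2\<le>n. if n1 + b ^ i * n2 = n
          then fls_nth f (int n1) * (\<sigma> ^^ i) (fls_nth g (int n2)) else 0)"
      using le by (simp add: sum.delta)
  qed
  finally show ?thesis .
qed

lemma integral_skew_mult:
  assumes "\<And>i. integral_fls (coeff P i)" "\<And>i. integral_fls (coeff Q i)"
  shows "integral_fls (coeff (skew_mult (phi \<sigma> b) P Q) i)"
  unfolding K.coeff_mult
  by (intro integral_fls_sum integral_fls_times integral_funpow_phi assms)

text \<open>\<open>n1 + b^i n2 = 0\<close> leaves only \<open>n1 = n2 = 0\<close>, so residues
  multiply in the skew ring over \<open>\<sigma>\<close>.\<close>

lemma digit_0_mult: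
  assumes "\<And>i. integral_fls (coeff P i)" "\<And>i. integral_fls (coeff Q i)"
  shows "digit 0 (skew_mult (phi \<sigma> b) P Q) = skew_mult \<sigma> (digit 0 P) (digit 0 Q)"
proof (rule poly_eqI)
  fix m
  have "fls_nth (coeff P i * (phi \<sigma> b ^^ i) (coeff Q (m - i))) 0 =
      fls_nth (coeff P i) 0 * (\<sigma> ^^ i) (fls_nth (coeff Q (m - i)) 0)" for i
    using nth_skew_term[OF assms(1)[of i] assms(2)[of "m - i"], of i 0] by simp
  then show "coeff (digit 0 (skew_mult (phi \<sigma> b) P Q)) m =
      coeff (skew_mult \<sigma> (digit 0 P) (digit 0 Q)) m"
    by (simp add: K.coeff_mult k.coeff_mult fls_nth_sum)
qed

end

context slope_twist
begin

text \<open>The exponents of \<open>T\<close> that \<open>supported\<close> admits at digit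
  \<open>n\<close>. In \<open>hensel_factors\<close>, level 0 is the set of multiples of
  \<open>l\<close>.\<close>

definition level :: "nat \<Rightarrow> nat set" where
  "level n = {i. int t dvd int n + shift_exp i}"

lemma level_add:
  assumes "i \<in> level m" "j \<in> level n"
  shows "i + j \<in> level (m + b ^ i * n)"
proof -
  have "int (m + b ^ i * n) + shift_exp (i + j) =
      (int m + shift_exp i) + int b ^ i * (int n + shift_exp j)"
    by (simp add: shift_exp_add algebra_simps)
  then show ?thesis
    using assms unfolding level_def mem_Collect_eq by (metis dvd_add dvd_mult)
qed

text \<open>Digit pairs of \<open>B\<close> and \<open>C\<close> are built recursively. At digit
  \<open>n > 0\<close> the unknowns enter as \<open>x C0 + b0 y\<close>: division by
  \<open>C0\<close> gives \<open>x\<close> as quotient and \<open>b0 y\<close> as remainder, of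
  degree below that of \<open>C0\<close>, so every step is solvable and \<open>C\<close> keeps the
  degree of \<open>C0\<close>.\<close>

lemma hensel_factors:
  assumes l: "\<And>i. int t dvd shift_exp i \<longleftrightarrow> l dvd i"
    and A_int: "\<And>i. integral_fls (coeff A i)" and A_supp: "supported A"
    and A0: "digit 0 A = skew_mult \<sigma> B0 C0"
    and B0: "coeff B0 0 \<noteq> 0" "\<And>i. coeff B0 i \<noteq> 0 \<Longrightarrow> l dvd i"
    and C0: "degree C0 > 0" "\<And>i. coeff C0 i \<noteq> 0 \<Longrightarrow> l dvd i"
  shows "\<exists>B C. A = skew_mult (phi \<sigma> b) B C \<and> supported B \<and> supported C \<and> degree C = degree C0"
proof -
  define c where "c = degree C0"
  \<comment> \<open>The bound \<open>D\<close> on the digits of \<open>B\<close>, together with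
    \<open>c\<close> on those of \<open>C\<close>, keeps every product within
    \<open>degree A\<close>.\<close>
  define D where "D = degree A - c"
  define b0 where "b0 = coeff B0 0"
  have C0_nz: "C0 \<noteq> 0" and B0_nz: "B0 \<noteq> 0" using C0(1) B0(1) by auto
  have "degree B0 + c \<le> degree A"
    using degree_digit_le[of 0 A] k.degree_mult[OF B0_nz C0_nz] by (simp add: A0 c_def)
  then have degB0: "degree B0 \<le> D" and cA: "D + c = degree A" by (auto simp: D_def)
  \<comment> \<open>The contribution to digit \<open>n\<close> of the pairs with both indices below
    \<open>n\<close>, all known at stage \<open>n\<close>.\<close>
  define rest :: "(nat \<Rightarrow> 'k poly \<times> 'k poly) \<Rightarrow> nat \<Rightarrow> 'k poly" where
    "rest f n = (\<Sum>i\<le>D. \<Sum>n1<n. \<Sum>n2<n. if n1 + b ^ i * n2 = n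
       then skew_mult \<sigma> (monom (coeff (fst (f n1)) i) i) (snd (f n2)) else 0)" for f n
  \<comment> \<open>Admissible exponents, degree bounds and the digit equation for the
    \<open>n\<close>-th pair. The remainder bound is strict only for \<open>n > 0\<close>, because
    digit 0 of \<open>C\<close> is \<open>C0\<close> itself, of degree \<open>c\<close>.\<close>
  define good where "good f n r \<longleftrightarrow>
      (\<forall>i. coeff (fst r) i \<noteq> 0 \<longrightarrow> i \<in> level n) \<and> (\<forall>i. coeff (snd r) i \<noteq> 0 \<longrightarrow> i \<in> level n) \<and>
      degree (fst r) \<le> D \<and> degree (snd r) \<le> c \<and> (n > 0 \<longrightarrow> degree (snd r) < c) \<and>
      (n = 0 \<longrightarrow> r = (B0, C0)) \<and>
      (n > 0 \<longrightarrow> digit (int n) A =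
         skew_mult \<sigma> (fst r) C0 + Polynomial.smult b0 (snd r) + rest f n)" for f n r
  have "\<exists>f. \<forall>n. good f n (f n)"
  \<comment> \<open>\<open>good f n\<close> consults \<open>f\<close> only below \<open>n\<close>,
    through \<open>rest\<close>, so the pairs can be chosen by well-founded recursion.\<close>
  proof (rule dependent_wf_choice[OF wf_less_than, where P = good])
    fix f g :: "nat \<Rightarrow> 'k poly \<times> 'k poly" and n r
    assume "\<And>z. (z, n) \<in> less_than \<Longrightarrow> f z = g z"
    then have "rest f n = rest g n" by (simp add: rest_def cong: if_cong)
    then show "good f n r = good g n r" by (simp add: good_def)
  next
    fix n :: nat and f :: "nat \<Rightarrow> 'k poly \<times> 'k poly"
    assume "\<And>y. (y, n) \<in> less_than \<Longrightarrow> good f y (f y)"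
    then have IH: "y < n \<Longrightarrow> good f y (f y)" for y by simp
    show "\<exists>r. good f n r"
    proof (cases "n = 0")
      case True
      then show ?thesis using B0 C0 degB0 l
        by (intro exI[of _ "(B0, C0)"]) (auto simp: good_def c_def level_def)
    next
      case False
      \<comment> \<open>What the earlier digits leave unexplained. Its exponents lie in
        \<open>level n\<close>: for digit \<open>n\<close> of \<open>A\<close> by
        \<open>A_supp\<close>, for \<open>rest\<close> by \<open>level_add\<close>.\<close>
      define E where "E = digit (int n) A - rest f n"
      have term_supp: "j \<in> level n \<and> j \<le> degree A"
        if "n1 < n" "n2 < n" "n1 + b ^ i * n2 = n"
          "coeff (skew_mult \<sigma> (monom (coeff (fst (f n1)) i) i) (snd (f n2))) j \<noteq> 0" for i n1 n2 j
      proof -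
        have *: "i \<le> j" "coeff (fst (f n1)) i \<noteq> 0" "coeff (snd (f n2)) (j - i) \<noteq> 0"
          using that(4) by (auto simp: k.coeff_monom_mult split: if_splits)
        then have "i \<in> level n1" "j - i \<in> level n2" "i \<le> D" "j - i \<le> c"
          using IH[OF that(1)] IH[OF that(2)] le_degree[OF *(2)] le_degree[OF *(3)]
          by (auto simp: good_def)
        then show ?thesis using level_add[of i n1 "j - i" n2] *(1) that(3) cA by auto
      qed
      have E_supp: "j \<in> level n \<and> j \<le> degree A" if "coeff E j \<noteq> 0" for j
      proof (cases "fls_nth (coeff A j) (int n) = 0")
        case True
        then have "coeff (rest f n) j \<noteq> 0" using that by (simp add: E_def)
        then obtain i n1 n2 where "n1 < n" "n2 < n"
          "coeff (if n1 + b ^ i * n2 = n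
             then skew_mult \<sigma> (monom (coeff (fst (f n1)) i) i) (snd (f n2)) else 0) j \<noteq> 0"
          unfolding rest_def coeff_sum by (auto elim!: sum.not_neutral_contains_not_neutral)
        then show ?thesis using term_supp[of n1 n2 i j] by (auto split: if_splits)
      next
        case False
        then have "coeff A j \<noteq> 0" by auto
        then show ?thesis using A_supp le_degree[of A j] False
          by (auto simp: supported_def level_def)
      qed
      have "\<exists>Q R. E = skew_mult \<sigma> Q C0 + R \<and> degree R < degree C0 \<and>
          degree Q \<le> degree E - degree C0 \<and>
          (\<forall>i. coeff Q i \<noteq> 0 \<longrightarrow> i \<in> level n) \<and> (\<forall>i. coeff R i \<noteq> 0 \<longrightarrow> i \<in> level n)"
      \<comment> \<open>\<open>level n\<close> is stable under translation by multiples of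
        \<open>l\<close>, since \<open>t\<close> divides the corresponding \<open>shift_exp\<close>;
        hence quotient and remainder stay in it.\<close>
      proof (rule k.division[OF C0_nz C0(1) C0(2)])
        fix i j assume "l dvd j"
        then have "int t dvd int b ^ i * shift_exp j" using l by simp
        then show "i + j \<in> level n \<longleftrightarrow> i \<in> level n"
          by (simp add: level_def shift_exp_add dvd_add_left_iff flip: add.assoc)
      qed (use E_supp in auto)
      then obtain Q R where QR: "E = skew_mult \<sigma> Q C0 + R" "degree R < c" "degree Q \<le> degree E - c"
        "\<forall>i. coeff Q i \<noteq> 0 \<longrightarrow> i \<in> level n" "\<forall>i. coeff R i \<noteq> 0 \<longrightarrow> i \<in> level n"
        by (auto simp: c_def)
      have "degree E \<le> degree A"
        using E_supp by (intro degree_le) (auto simp: not_le[symmetric])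
      then have "degree Q \<le> D" using QR(3) by (simp add: D_def)
      \<comment> \<open>The quotient becomes the new digit of \<open>B\<close>, the remainder
        divided by \<open>b0\<close> that of \<open>C\<close>.\<close>
      moreover have "digit (int n) A =
          skew_mult \<sigma> Q C0 + Polynomial.smult b0 (Polynomial.smult (inverse b0) R) + rest f n"
        using QR(1) B0(1) by (simp add: E_def b0_def algebra_simps)
      ultimately have "good f n (Q, Polynomial.smult (inverse b0) R)"
        using QR False by (auto simp: good_def)
      then show ?thesis ..
    qed
  qed
  then obtain f where f: "\<And>n. good f n (f n)" by blast
  define x where "x n i = coeff (fst (f n)) i" for n i
  define y where "y n i = coeff (snd (f n)) i" for n i
  have xy0: "x 0 i = coeff B0 i" "y 0 i = coeff C0 i" for i
    using f[of 0] by (auto simp: good_def x_def y_def)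
  have x_large: "x n i = 0" if "i > D" for n i
    using f[of n] that by (auto simp: good_def x_def intro!: coeff_eq_0)
  have y_large: "y n i = 0" if "i > c" for n i
    using f[of n] that by (auto simp: good_def y_def intro!: coeff_eq_0)
  \<comment> \<open>The degree bounds are uniform in \<open>n\<close>, so the digit sequences
    assemble into polynomials.\<close>
  define B where "B = (\<Sum>i\<le>D. monom (fps_to_fls (Abs_fps (\<lambda>n. x n i))) i)"
  define C where "C = (\<Sum>i\<le>c. monom (fps_to_fls (Abs_fps (\<lambda>n. y n i))) i)"
  have coeff_poly: "coeff (\<Sum>i\<le>N. monom (z i) i) j = (if j \<le> N then z j else 0)"
    for z :: "nat \<Rightarrow> 'k fls" and N j
  proof -
    have "coeff (\<Sum>i\<le>N. monom (z i) i) j = (\<Sum>i\<le>N. if i = j then z j else 0)"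
      unfolding coeff_sum by (rule sum.cong) auto
    then show ?thesis by simp
  qed
  have coeff_B: "coeff B i = fps_to_fls (Abs_fps (\<lambda>n. x n i))" for i
    by (auto simp: B_def coeff_poly x_large not_le fps_eq_iff intro!: fls_eqI)
  have coeff_C: "coeff C i = fps_to_fls (Abs_fps (\<lambda>n. y n i))" for i
    by (auto simp: C_def coeff_poly y_large not_le fps_eq_iff intro!: fls_eqI)
  have B_int: "integral_fls (coeff B i)" and C_int: "integral_fls (coeff C i)" for i
    by (auto simp: coeff_B coeff_C integral_fls_def)
  have nthB: "fls_nth (coeff B i) (int n) = x n i" and nthC: "fls_nth (coeff C i) (int n) = y n i" for i n
    by (simp_all add: coeff_B coeff_C)
  have prod: "fls_nth (coeff (skew_mult (phi \<sigma> b) B C) m) (int n) = fls_nth (coeff A m) (int n)" for m n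
  proof -
    define G where "G i n1 n2 = (if n1 + b ^ i * n2 = n then x n1 i * (\<sigma> ^^ i) (y n2 (m - i)) else 0)"
      for i n1 n2
    have 1: "fls_nth (coeff (skew_mult (phi \<sigma> b) B C) m) (int n) =
        (\<Sum>i\<le>m. \<Sum>n1\<le>n. \<Sum>n2\<le>n. G i n1 n2)"
      by (simp add: K.coeff_mult fls_nth_sum nth_skew_term[OF B_int C_int] nthB nthC G_def cong: if_cong)
    show ?thesis
    proof (cases "n = 0")
      case True
      have "(\<Sum>i\<le>m. \<Sum>n1\<le>n. \<Sum>n2\<le>n. G i n1 n2) = coeff (skew_mult \<sigma> B0 C0) m"
        using True by (simp add: G_def xy0 k.coeff_mult)
      then show ?thesis unfolding 1 using True by (simp flip: A0)
    next
      case False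
      then have n: "n > 0" by simp
      have "(\<Sum>i\<le>m. \<Sum>n1\<le>n. \<Sum>n2\<le>n. G i n1 n2) =
          (\<Sum>i\<le>m. (\<Sum>n1<n. \<Sum>n2<n. G i n1 n2) + x n i * (\<sigma> ^^ i) (y 0 (m - i))
             + (if i = 0 then x 0 i * (\<sigma> ^^ i) (y n (m - i)) else 0))"
        unfolding G_def
        by (intro sum.cong refl weighted_convolution_split[where x = "\<lambda>n1. x n1 _" and
              y = "\<lambda>n2. (\<sigma> ^^ _) (y n2 _)"] n b_ge_2)
      also have "\<dots> = (\<Sum>i\<le>m. \<Sum>n1<n. \<Sum>n2<n. G i n1 n2) +
          coeff (skew_mult \<sigma> (fst (f n)) C0) m + b0 * y n m"
        by (simp add: sum.distrib k.coeff_mult xy0 x_def[symmetric] b0_def)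
      also have "(\<Sum>i\<le>m. \<Sum>n1<n. \<Sum>n2<n. G i n1 n2) = coeff (rest f n) m"
      proof -
        have "coeff (rest f n) m = (\<Sum>i\<le>D. \<Sum>n1<n. \<Sum>n2<n. if i \<le> m then G i n1 n2 else 0)"
          unfolding rest_def coeff_sum
          by (intro sum.cong refl) (auto simp: G_def k.coeff_monom_mult x_def y_def)
        \<comment> \<open>Indices above \<open>D\<close> contribute nothing because \<open>x\<close>
          vanishes there; those above \<open>m\<close> are cut off by the monomial.\<close>
        also have "\<dots> = (\<Sum>i\<le>m. \<Sum>n1<n. \<Sum>n2<n. G i n1 n2)"
          by (rule sum.mono_neutral_cong) (auto simp: G_def x_large intro!: sum.neutral)
        finally show ?thesis ..
      qed
      also have "coeff (rest f n) m + coeff (skew_mult \<sigma> (fst (f n)) C0) m + b0 * y n m =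
          coeff (digit (int n) A) m"
        using f[of n] n by (simp add: good_def y_def add_ac)
      finally show ?thesis unfolding 1 by simp
    qed
  qed
  have "A = skew_mult (phi \<sigma> b) B C"
  proof (intro poly_eqI fls_eqI)
    fix m and n :: int
    show "fls_nth (coeff A m) n = fls_nth (coeff (skew_mult (phi \<sigma> b) B C) m) n"
    proof (cases "n < 0")
      case True
      then show ?thesis
        using A_int[of m] integral_skew_mult[OF B_int C_int, of m] by (simp add: integral_fls_def)
    next
      case False
      then show ?thesis using prod[of m "nat n"] by simp
    qed
  qed
  moreover have "supported B"
    using f by (auto simp: supported_def coeff_B good_def x_def level_def split: if_splits)
      (metis nat_0_le not_less)
  moreover have "supported C"
    using f by (auto simp: supported_def coeff_C good_def y_def level_def split: if_splits)
      (metis nat_0_le not_less)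
  moreover have "degree C = c"
  proof (rule antisym)
    show "degree C \<le> c"
      unfolding C_def by (intro degree_sum_le) (auto intro: order_trans[OF degree_monom_le])
    \<comment> \<open>Digit 0 of \<open>C\<close> is \<open>C0\<close>, whose leading coefficient
      survives at \<open>c\<close>.\<close>
    have "fls_nth (coeff C c) (int 0) \<noteq> 0"
      unfolding nthC xy0 using C0_nz by (simp add: c_def)
    then show "c \<le> degree C" by (intro le_degree) auto
  qed
  ultimately show ?thesis unfolding c_def by blast
qed

end

section \<open>Reductions of products\<close>

text \<open>\<open>x\<close> is the Gauss valuation of \<open>P\<close>, the minimum of the
  valuations of its finitely many nonzero coefficients.\<close>

lemma ex_lowest_digit:
  assumes "P \<noteq> (0 :: 'a::zero fls poly)"
  shows "\<exists>x. (\<forall>i n. n < x \<longrightarrow> fls_nth (coeff P i) n = 0) \<and> digit x P \<noteq> 0"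
proof -
  define I where "I = {i. coeff P i \<noteq> 0}"
  have fin: "finite I"
    unfolding I_def by (rule finite_subset[of _ "{..degree P}"]) (auto intro: le_degree)
  have ne: "I \<noteq> {}" using assms by (auto simp: I_def poly_eq_iff)
  define x where "x = Min ((\<lambda>i. fls_subdegree (coeff P i)) ` I)"
  have "x \<in> (\<lambda>i. fls_subdegree (coeff P i)) ` I"
    unfolding x_def by (rule Min_in) (use fin ne in auto)
  then obtain j where j: "j \<in> I" "x = fls_subdegree (coeff P j)" by blast
  have "x \<le> fls_subdegree (coeff P i)" if "i \<in> I" for i
    unfolding x_def using that fin by simp
  then have "fls_nth (coeff P i) n = 0" if "n < x" for i n
    using that by (cases "i \<in> I") (fastforce simp: I_def)+
  moreover have "coeff (digit x P) j \<noteq> 0"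
    using j by (auto simp: I_def)
  ultimately show ?thesis by (metis coeff_0)
qed

lemma coeff_smult_X_intpow:
  "coeff (Polynomial.smult (fls_X_intpow n) P) i = fls_shift (- n) (coeff P i :: 'a::field fls)"
  by (simp add: fls_X_intpow_times_conv_shift)

lemma digit_smult_X_intpow:
  "digit n (Polynomial.smult (fls_X_intpow m) P) = digit (n - m) (P :: 'a::field fls poly)"
  by (rule poly_eqI) (simp add: fls_X_intpow_times_conv_shift)

context slope_twist
begin

text \<open>The right factor is normalised by a power of the uniformiser, which is moved to the left
  factor before that one is normalised as well.\<close>

lemma reduction_of_product:
  assumes l: "\<And>i. int t dvd shift_exp i \<longleftrightarrow> l dvd i"
    and A: "A = skew_mult (phi \<sigma> b) B C"
    and low: "\<And>i n. n < v \<Longrightarrow> fls_nth (coeff (twist A) i) n = 0"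
    and v: "fls_nth (coeff (twist A) 0) v \<noteq> 0" "fls_nth (coeff (twist A) (degree A)) v \<noteq> 0"
  shows "\<exists>B0 C0. digit v (twist A) = skew_mult \<sigma> B0 C0 \<and> degree B0 = degree B \<and> degree C0 = degree C \<and>
           (\<forall>i. coeff B0 i \<noteq> 0 \<longrightarrow> l dvd i) \<and> (\<forall>i. coeff C0 i \<noteq> 0 \<longrightarrow> l dvd i)"
proof -
  have A_nz: "A \<noteq> 0" using v(1) by auto
  then have BC_nz: "B \<noteq> 0" "C \<noteq> 0" using A by auto
  have tw_nz: "twist P \<noteq> 0" if "P \<noteq> 0" for P
    using that by (auto simp: poly_eq_iff)
  obtain x where x: "\<And>i n. n < x \<Longrightarrow> fls_nth (coeff (twist C) i) n = 0" "digit x (twist C) \<noteq> 0"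
    using ex_lowest_digit[OF tw_nz[OF BC_nz(2)]] by blast
  define C1 where "C1 = Polynomial.smult (fls_X_intpow (- x)) (twist C)"
  define B1 where "B1 = skew_mult (phi \<sigma> b) (twist B) [:fls_X_intpow x:]"
  have "skew_mult (phi \<sigma> b) B1 C1 = skew_mult (phi \<sigma> b) (twist B) (skew_mult (phi \<sigma> b) [:fls_X_intpow x:] C1)"
    unfolding B1_def by (rule K.mult_assoc)
  also have "skew_mult (phi \<sigma> b) [:fls_X_intpow x:] C1 = twist C"
    unfolding C1_def K.const_mult by (simp add: fls_X_intpow_times_conv_shift)
  finally have prod1: "skew_mult (phi \<sigma> b) B1 C1 = twist A"
    by (simp add: A twist_mult)
  then have "B1 \<noteq> 0" using tw_nz[OF A_nz] by auto
  then obtain y where y: "\<And>i n. n < y \<Longrightarrow> fls_nth (coeff B1 i) n = 0" "digit y B1 \<noteq> 0"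
    using ex_lowest_digit by blast
  define B2 where "B2 = Polynomial.smult (fls_X_intpow (- y)) B1"
  have prod2: "skew_mult (phi \<sigma> b) B2 C1 = Polynomial.smult (fls_X_intpow (- y)) (twist A)"
    unfolding B2_def K.smult_mult prod1 ..
  have int: "integral_fls (coeff B2 i)" "integral_fls (coeff C1 i)" for i
    unfolding B2_def C1_def coeff_smult_X_intpow integral_fls_def using x(1) y(1)
    by (simp_all del: coeff_twist)
  define B0 where "B0 = digit y B1"
  define C0 where "C0 = digit x (twist C)"
  have red: "digit y (twist A) = skew_mult \<sigma> B0 C0"
    using digit_0_mult[OF int] unfolding prod2 unfolding B2_def C1_def digit_smult_X_intpow B0_def C0_def
    by simp
  \<comment> \<open>Gauss's lemma: the residue of the product is nonzero because the ring over
    \<open>\<sigma>\<close> has no zero divisors, which gives \<open>v \<le> y\<close>; integrality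
    of the product gives \<open>y \<le> v\<close>.\<close>
  then have "digit y (twist A) \<noteq> 0"
    using x(2) y(2) by (simp add: k.mult_eq_0_iff B0_def C0_def)
  then obtain j where j: "fls_nth (coeff (twist A) j) y \<noteq> 0" by (metis coeff_digit poly_eqI coeff_0)
  have "integral_fls (coeff (Polynomial.smult (fls_X_intpow (- y)) (twist A)) 0)"
    using integral_skew_mult[OF int] unfolding prod2 .
  then have "fls_nth (coeff (twist A) 0) n = 0" if "n < y" for n
    using that unfolding coeff_smult_X_intpow integral_fls_def by (metis add_diff_cancel_right' diff_add_cancel
      diff_less_0_iff_less fls_shift_nth minus_minus)
  then have yv: "y = v" using j low v(1) by (metis linorder_neqE)
  have "fls_nth (coeff (twist A) 0) v = coeff B0 0 * coeff C0 0"
    using red yv by (metis coeff_digit k.coeff_0_mult)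
  then have "coeff B0 0 \<noteq> 0" "coeff C0 0 \<noteq> 0" using v(1) by auto
  then have nz: "B0 \<noteq> 0" "C0 \<noteq> 0" "fls_nth (coeff (twist C) 0) x \<noteq> 0"
    by (metis coeff_0, metis coeff_0, simp add: C0_def del: coeff_twist)
  \<comment> \<open>At \<open>T^0\<close> the shift vanishes, so nonzero constant terms make
    \<open>x\<close> and \<open>y\<close> multiples of \<open>t\<close>; the support conditions then
    reduce to \<open>t\<close> dividing \<open>shift_exp i\<close>.\<close>
  have tx: "int t dvd x" and ty: "int t dvd y"
    using supportedD[OF supported_twist nz(3)] supportedD[OF supported_twist v(1)] yv by simp_all
  have coeff_B1: "coeff B1 i = fls_shift (- (int b ^ i * x)) (coeff (twist B) i)" for i
    unfolding B1_def K.coeff_mult_const by (simp add: funpow_phi_shift fls_shifted_times_simps)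
  have suppB: "l dvd i" if "coeff B0 i \<noteq> 0" for i
  proof -
    have "int t dvd (y - int b ^ i * x) + shift_exp i"
      using that by (intro supportedD[OF supported_twist[of B]]) (simp add: B0_def coeff_B1 del: coeff_twist)
    moreover have "int t dvd y - int b ^ i * x" using tx ty by auto
    ultimately show ?thesis using dvd_add_right_iff l by blast
  qed
  have suppC: "l dvd i" if "coeff C0 i \<noteq> 0" for i
  proof -
    have "int t dvd x + shift_exp i"
      using that by (intro supportedD[OF supported_twist[of C]]) (simp add: C0_def del: coeff_twist)
    then show ?thesis using tx l dvd_add_right_iff by blast
  qed
  \<comment> \<open>The degrees are squeezed: \<open>degree A \<le> degree B0 + degree C0 \<le>
    degree B + degree C = degree A\<close>.\<close>
  have "degree (digit v (twist A)) \<ge> degree A"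
    using v(2) by (intro le_degree) simp
  moreover have "degree (digit v (twist A)) = degree B0 + degree C0"
    using red yv k.degree_mult[OF nz(1,2)] by simp
  moreover have "degree A = degree B + degree C"
    unfolding A by (rule K.degree_mult[OF BC_nz])
  moreover have "degree B0 \<le> degree B"
    unfolding B0_def by (rule degree_le) (simp add: coeff_B1 coeff_eq_0)
  moreover have "degree C0 \<le> degree C"
    unfolding C0_def using degree_digit_le[of x "twist C"] by simp
  ultimately have "degree B0 = degree B \<and> degree C0 = degree C" by linarith
  then show ?thesis using red yv suppB suppC by blast
qed

end

section \<open>Monoclinic Newton polygons\<close>

text \<open>Among the lines joining the base point to the others, the one of least slope passes
  below all points and touches one.\<close>

lemma ex_supporting_slope:
  fixes v x :: "nat \<Rightarrow> 'a::linordered_field"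
  assumes "finite I" "I \<noteq> {}" "\<And>i. i \<in> I \<Longrightarrow> x0 < x i"
  shows "\<exists>m. (\<exists>i\<in>I. v i = v0 + (x i - x0) * m) \<and> (\<forall>i\<in>I. v0 + (x i - x0) * m \<le> v i)"
proof -
  define m where "m = Min ((\<lambda>i. (v i - v0) / (x i - x0)) ` I)"
  have "m \<in> (\<lambda>i. (v i - v0) / (x i - x0)) ` I"
    unfolding m_def by (rule Min_in) (use assms in auto)
  then obtain j where "j \<in> I" "m = (v j - v0) / (x j - x0)" by blast
  moreover from this have "v j = v0 + (x j - x0) * m"
    using assms(3)[of j] by simp
  moreover have "v0 + (x i - x0) * m \<le> v i" if "i \<in> I" for i
  proof -
    have "m \<le> (v i - v0) / (x i - x0)" unfolding m_def using that assms(1) by simp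
    then show ?thesis using assms(3)[OF that] by (simp add: pos_le_divide_eq algebra_simps)
  qed
  ultimately show ?thesis by blast
qed

text \<open>The monoclinic condition in terms of vertices: the first and the last lie on a line of
  slope \<open>m\<close> and no point lies below it. The generic field permits passing between real
  and rational slopes.\<close>

definition on_slope :: "nat \<Rightarrow> 'k::zero fls poly \<Rightarrow> nat \<Rightarrow> 'a::linordered_field \<Rightarrow> bool" where
  "on_slope b A i0 m \<longleftrightarrow> i0 < degree A \<and> coeff A i0 \<noteq> 0 \<and> (\<forall>i<i0. coeff A i = 0) \<and>
     (\<forall>i. coeff A i \<noteq> 0 \<longrightarrow> of_int (fls_subdegree (coeff A i0)) + (of_nat b ^ i - of_nat b ^ i0) * m
        \<le> of_int (fls_subdegree (coeff A i))) \<and>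
     of_int (fls_subdegree (lead_coeff A)) =
       of_int (fls_subdegree (coeff A i0)) + (of_nat b ^ degree A - of_nat b ^ i0) * m"

lemma on_slope_of_rat:
  "on_slope b A i0 (of_rat \<mu> :: real) \<longleftrightarrow> on_slope b A i0 \<mu>"
proof -
  have "of_int x + (of_nat b ^ i - of_nat b ^ i0) * of_rat \<mu> =
      (of_rat (of_int x + (of_nat b ^ i - of_nat b ^ i0) * \<mu>) :: real)" for x i
    by (simp add: of_rat_add of_rat_mult of_rat_diff of_rat_power)
  moreover have "(of_int x :: real) = of_rat (of_int x)" for x by simp
  ultimately show ?thesis
    unfolding on_slope_def by (simp only: of_rat_less_eq of_rat_eq_iff)
qed

text \<open>A closed half-plane that contains the generators contains their convex hull.\<close>

lemma newton_region_above:
  assumes "\<And>i. coeff A i \<noteq> 0 \<Longrightarrow> c + real b ^ i * m \<le> real_of_int (fls_subdegree (coeff A i))"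
    and "P \<in> newton_region b A"
  shows "c + fst P * m \<le> snd P"
proof -
  have "{(real b ^ i, y) | i y. coeff A i \<noteq> 0 \<and> real_of_int (fls_subdegree (coeff A i)) \<le> y}
      \<subseteq> {P. inner (- m, 1) P \<ge> c}"
    using assms(1) by (fastforce simp: inner_prod_def mult.commute)
  then have "newton_region b A \<subseteq> {P. inner (- m, 1) P \<ge> c}"
    unfolding newton_region_def by (intro hull_minimal convex_halfspace_ge)
  then show ?thesis using assms(2) by (auto simp: inner_prod_def mult.commute)
qed

lemma newton_region_strip:
  assumes "\<And>i. coeff A i \<noteq> 0 \<Longrightarrow> i0 \<le> i" "b \<ge> 1" "P \<in> newton_region b A"
  shows "real b ^ i0 \<le> fst P" "fst P \<le> real b ^ degree A"
proof -
  let ?V = "{(real b ^ i, y) | i y. coeff A i \<noteq> 0 \<and> real_of_int (fls_subdegree (coeff A i)) \<le> y}"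
  have "?V \<subseteq> {P. inner (1, 0) P \<ge> real b ^ i0}"
    using assms(1,2) by (auto simp: inner_prod_def intro!: power_increasing)
  then have "newton_region b A \<subseteq> {P. inner (1, 0) P \<ge> real b ^ i0}"
    unfolding newton_region_def by (intro hull_minimal convex_halfspace_ge)
  then show "real b ^ i0 \<le> fst P" using assms(3) by (auto simp: inner_prod_def)
  have "?V \<subseteq> {P. inner (1, 0) P \<le> real b ^ degree A}"
    using assms(2) by (auto simp: inner_prod_def intro!: power_increasing le_degree)
  then have "newton_region b A \<subseteq> {P. inner (1, 0) P \<le> real b ^ degree A}"
    unfolding newton_region_def by (intro hull_minimal convex_halfspace_le)
  then show "fst P \<le> real b ^ degree A" using assms(3) by (auto simp: inner_prod_def)
qed

text \<open>The segment lies in the hull by convexity, and the hull does not go below a supporting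
  line.\<close>

lemma newton_segment:
  fixes A :: "'k::zero fls poly"
  assumes above: "\<And>i. coeff A i \<noteq> 0 \<Longrightarrow> c + real b ^ i * m \<le> real_of_int (fls_subdegree (coeff A i))"
    and i: "coeff A i \<noteq> 0" "real_of_int (fls_subdegree (coeff A i)) = c + real b ^ i * m"
    and j: "coeff A j \<noteq> 0" "real_of_int (fls_subdegree (coeff A j)) = c + real b ^ j * m"
    and x: "real b ^ i \<le> x" "x \<le> real b ^ j"
  shows "(x, c + x * m) \<in> newton_polygon b A"
proof -
  let ?P = "\<lambda>x. (x, c + x * m)"
  have region: "?P (real b ^ i) \<in> newton_region b A" "?P (real b ^ j) \<in> newton_region b A"
    unfolding newton_region_def by (rule hull_inc, use i j in force)+
  have "?P x \<in> newton_region b A"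
  proof (cases "real b ^ i = real b ^ j")
    case True
    then show ?thesis using x region(1) by simp
  next
    case False
    define u where "u = (x - real b ^ i) / (real b ^ j - real b ^ i)"
    have "u * (real b ^ j - real b ^ i) = x - real b ^ i"
      using False by (simp add: u_def)
    then have u: "0 \<le> u" "u \<le> 1" "(1 - u) * real b ^ i + u * real b ^ j = x"
      using x False by (simp add: u_def, simp add: u_def, simp add: algebra_simps)
    have "(1 - u) *\<^sub>R ?P (real b ^ i) + u *\<^sub>R ?P (real b ^ j) \<in> newton_region b A"
      using region u unfolding newton_region_def
      by (intro convexD[OF convex_convex_hull]) auto
    also have "(1 - u) *\<^sub>R ?P (real b ^ i) + u *\<^sub>R ?P (real b ^ j) = ?P x"
      by (simp add: u(3)[symmetric] algebra_simps)
    finally show ?thesis .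
  qed
  then show ?thesis
    unfolding newton_polygon_def using newton_region_above[OF above] by fastforce
qed

lemma newton_slopesI:
  fixes A :: "'k::zero fls poly"
  assumes above: "\<And>i. coeff A i \<noteq> 0 \<Longrightarrow> c + real b ^ i * m \<le> real_of_int (fls_subdegree (coeff A i))"
    and i: "coeff A i \<noteq> 0" "real_of_int (fls_subdegree (coeff A i)) = c + real b ^ i * m"
    and j: "coeff A j \<noteq> 0" "real_of_int (fls_subdegree (coeff A j)) = c + real b ^ j * m"
    and ij: "i < j" "b \<ge> 2"
  shows "m \<in> newton_slopes b A"
proof -
  let ?P = "\<lambda>x. (x, c + x * m)"
  have lt: "real b ^ i < real b ^ j" using ij by (intro power_strict_increasing) auto
  have "closed_segment (?P (real b ^ i)) (?P (real b ^ j)) \<subseteq> newton_polygon b A"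
  proof
    fix Q assume "Q \<in> closed_segment (?P (real b ^ i)) (?P (real b ^ j))"
    then obtain u where u: "0 \<le> u" "u \<le> 1" "Q = (1 - u) *\<^sub>R ?P (real b ^ i) + u *\<^sub>R ?P (real b ^ j)"
      by (auto simp: in_segment)
    define x where "x = (1 - u) * real b ^ i + u * real b ^ j"
    have "Q = ?P x" unfolding u(3) x_def by (simp add: algebra_simps)
    moreover have "x = real b ^ i + u * (real b ^ j - real b ^ i)"
      "x = real b ^ j - (1 - u) * (real b ^ j - real b ^ i)"
      by (simp_all add: x_def algebra_simps)
    then have "real b ^ i \<le> x" "x \<le> real b ^ j"
      using u(1,2) lt mult_nonneg_nonneg[of u "real b ^ j - real b ^ i"]
        mult_nonneg_nonneg[of "1 - u" "real b ^ j - real b ^ i"] by linarith+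
    ultimately show "Q \<in> newton_polygon b A" using newton_segment[OF above i j] by simp
  qed
  moreover have "m = (snd (?P (real b ^ j)) - snd (?P (real b ^ i))) / (fst (?P (real b ^ j)) - fst (?P (real b ^ i)))"
    using lt by (simp add: field_simps)
  ultimately show ?thesis
    unfolding newton_slopes_def using lt by fastforce
qed

text \<open>The abscissae of the region lie between those of the vertices at \<open>i0\<close> and
  \<open>degree A\<close>, so the entire polygon lies on the line through them and every chord has
  slope \<open>m\<close>.\<close>

lemma newton_slopes_eq_singleton:
  assumes "on_slope b A i0 m" "b \<ge> 2"
  shows "newton_slopes b A = {m}"
proof -
  define d where "d = degree A"
  define c where "c = real_of_int (fls_subdegree (coeff A i0)) - real b ^ i0 * m"
  note os = assms(1)[unfolded on_slope_def, folded d_def]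
  have above: "c + real b ^ i * m \<le> real_of_int (fls_subdegree (coeff A i))" if "coeff A i \<noteq> 0" for i
    using os that by (simp add: c_def algebra_simps)
  have i: "coeff A i0 \<noteq> 0" "real_of_int (fls_subdegree (coeff A i0)) = c + real b ^ i0 * m"
    using os by (simp_all add: c_def)
  have d: "coeff A d \<noteq> 0" "real_of_int (fls_subdegree (coeff A d)) = c + real b ^ d * m"
    using os by (auto simp: c_def d_def algebra_simps)
  have i0: "i0 \<le> i" if "coeff A i \<noteq> 0" for i using os that not_le by blast
  have line: "snd P = c + fst P * m" if "P \<in> newton_polygon b A" for P
  proof -
    have P: "P \<in> newton_region b A" "\<And>y'. (fst P, y') \<in> newton_region b A \<Longrightarrow> snd P \<le> y'"
      using that by (auto simp: newton_polygon_def)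
    have "(fst P, c + fst P * m) \<in> newton_polygon b A"
      by (rule newton_segment[OF above i d])
        (use newton_region_strip[of A i0 b P] i0 assms(2) P in \<open>auto simp: d_def\<close>)
    then have "snd P \<le> c + fst P * m" by (intro P) (auto simp: newton_polygon_def)
    moreover have "c + fst P * m \<le> snd P" using above P(1) by (rule newton_region_above)
    ultimately show ?thesis by simp
  qed
  have "s = m" if s: "s \<in> newton_slopes b A" for s
  proof -
    obtain P Q where PQ: "fst P < fst Q" "closed_segment P Q \<subseteq> newton_polygon b A"
      "s = (snd Q - snd P) / (fst Q - fst P)"
      using s by (auto simp: newton_slopes_def)
    have "P \<in> newton_polygon b A" "Q \<in> newton_polygon b A" using PQ(2) by auto
    then have "snd Q - snd P = m * (fst Q - fst P)" using line by (simp add: algebra_simps)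
    then show ?thesis using PQ by simp
  qed
  moreover have "m \<in> newton_slopes b A"
    by (rule newton_slopesI[OF above i d]) (use os assms(2) in auto)
  ultimately show ?thesis by blast
qed

text \<open>The supporting lines at the first and at the last vertex each yield a slope. As both
  equal \<open>m\<close>, each end point is on or above the line through the other, so the two lines
  coincide.\<close>

lemma ex_on_slope:
  fixes A :: "'k::zero fls poly"
  assumes "newton_slopes b A = {m}" "b \<ge> 2"
  shows "\<exists>i0. on_slope b A i0 m"
proof -
  define d where "d = degree A"
  define I where "I = {i. coeff A i \<noteq> 0}"
  define v where "v i = real_of_int (fls_subdegree (coeff A i))" for i
  have fin: "finite I" unfolding I_def by (rule finite_subset[of _ "{..d}"]) (auto intro: le_degree simp: d_def)
  obtain P Q where PQ: "fst P < fst Q" "closed_segment P Q \<subseteq> newton_polygon b A"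
    using assms(1) by (auto simp: newton_slopes_def set_eq_iff)
  then have PQ': "P \<in> newton_region b A" "Q \<in> newton_region b A"
    by (auto simp: newton_polygon_def)
  have ne: "\<exists>i. coeff A i \<noteq> 0"
  proof (rule ccontr)
    assume "\<nexists>i. coeff A i \<noteq> 0"
    then have "newton_region b A = {}" by (simp add: newton_region_def)
    then show False using PQ' by simp
  qed
  define i0 where "i0 = (LEAST i. coeff A i \<noteq> 0)"
  have i0: "coeff A i0 \<noteq> 0" "\<And>i. coeff A i \<noteq> 0 \<Longrightarrow> i0 \<le> i"
    using LeastI_ex[OF ne] unfolding i0_def by (auto intro: Least_le)
  have d: "coeff A d \<noteq> 0" "\<And>i. coeff A i \<noteq> 0 \<Longrightarrow> i \<le> d"
    using ne by (auto simp: d_def intro: le_degree)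
  have "real b ^ i0 \<le> fst P" "fst Q \<le> real b ^ d"
    using newton_region_strip[of A i0 b] i0(2) assms(2) PQ' by (auto simp: d_def)
  then have "real b ^ i0 < real b ^ d" using PQ(1) by linarith
  then have i0d: "i0 < d" using assms(2) by (intro power_less_imp_less_exp[of "real b"]) auto
  have mono: "real b ^ i < real b ^ j" if "i < j" for i j
    using that assms(2) by (intro power_strict_increasing) auto
  have "\<exists>m1. (\<exists>i\<in>I - {i0}. v i = v i0 + (real b ^ i - real b ^ i0) * m1) \<and>
      (\<forall>i\<in>I - {i0}. v i0 + (real b ^ i - real b ^ i0) * m1 \<le> v i)"
  proof (rule ex_supporting_slope)
    show "I - {i0} \<noteq> {}" using d(1) i0d by (auto simp: I_def)
    show "real b ^ i0 < real b ^ i" if "i \<in> I - {i0}" for i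
      using that i0(2)[of i] by (intro mono) (auto simp: I_def)
  qed (use fin in simp)
  then obtain m1 i1 where m1: "i1 \<in> I - {i0}" "v i1 = v i0 + (real b ^ i1 - real b ^ i0) * m1"
    "\<And>i. i \<in> I - {i0} \<Longrightarrow> v i0 + (real b ^ i - real b ^ i0) * m1 \<le> v i"
    by blast
  have i1: "coeff A i1 \<noteq> 0" "i0 < i1"
    using m1(1) i0(2)[of i1] by (auto simp: I_def)
  have "m1 \<in> newton_slopes b A"
  proof (rule newton_slopesI[of A "v i0 - real b ^ i0 * m1" b m1 i0 i1])
    show "v i0 - real b ^ i0 * m1 + real b ^ i * m1 \<le> real_of_int (fls_subdegree (coeff A i))"
      if "coeff A i \<noteq> 0" for i
      using m1(3)[of i] that by (cases "i = i0") (auto simp: I_def v_def algebra_simps)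
  qed (use m1(2) i0(1) i1 assms(2) in \<open>simp_all add: v_def algebra_simps\<close>)
  then have m1m: "m1 = m" using assms(1) by simp
  \<comment> \<open>The same minimality argument from the right end: negated abscissae put the last
    vertex first, which also negates the slope.\<close>
  have "\<exists>m2. (\<exists>i\<in>I - {d}. v i = v d + (- (real b ^ i) - - (real b ^ d)) * m2) \<and>
      (\<forall>i\<in>I - {d}. v d + (- (real b ^ i) - - (real b ^ d)) * m2 \<le> v i)"
  proof (rule ex_supporting_slope)
    show "I - {d} \<noteq> {}" using i0(1) i0d by (auto simp: I_def)
    show "- (real b ^ d) < - (real b ^ i)" if "i \<in> I - {d}" for i
      using that d(2)[of i] mono[of i d] by (auto simp: I_def)
  qed (use fin in simp)
  then obtain m2 i2 where m2: "i2 \<in> I - {d}" "v i2 = v d + (- (real b ^ i2) - - (real b ^ d)) * m2"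
    "\<And>i. i \<in> I - {d} \<Longrightarrow> v d + (- (real b ^ i) - - (real b ^ d)) * m2 \<le> v i"
    by blast
  have i2: "coeff A i2 \<noteq> 0" "i2 < d"
    using m2(1) d(2)[of i2] by (auto simp: I_def)
  have "- m2 \<in> newton_slopes b A"
  proof (rule newton_slopesI[of A "v d + real b ^ d * m2" b "- m2" i2 d])
    show "v d + real b ^ d * m2 + real b ^ i * - m2 \<le> real_of_int (fls_subdegree (coeff A i))"
      if "coeff A i \<noteq> 0" for i
      using m2(3)[of i] that by (cases "i = d") (auto simp: I_def v_def algebra_simps)
  qed (use m2(2) d(1) i2 assms(2) in \<open>simp_all add: v_def algebra_simps\<close>)
  then have m2m: "m2 = - m" using assms(1) by simp
  have "v d = v i0 + (real b ^ d - real b ^ i0) * m"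
    using m1(3)[of d] m2(3)[of i0] i0 d i0d by (simp add: I_def m1m m2m algebra_simps)
  moreover have "v i0 + (real b ^ i - real b ^ i0) * m \<le> v i" if "coeff A i \<noteq> 0" for i
    using m1(3)[of i] that by (cases "i = i0") (auto simp: I_def m1m)
  ultimately have "on_slope b A i0 m"
    using i0 i0d not_le unfolding on_slope_def d_def v_def by auto
  then show ?thesis ..
qed

lemma monoclinic_iff_on_slope:
  assumes "b \<ge> 2"
  shows "monoclinic_of_slope b A \<mu> \<longleftrightarrow> (\<exists>i0. on_slope b A i0 \<mu>)"
  unfolding monoclinic_of_slope_def on_slope_of_rat[symmetric]
  using ex_on_slope newton_slopes_eq_singleton assms by metis

section \<open>Reduction along a slope\<close>

text \<open>Justifies the definite description in \<open>b_length\<close>. With the powers of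
  \<open>b\<close> collected on one side, coprimality to \<open>b\<close> makes each denominator
  divide the other.\<close>

lemma b_length_denominator_unique:
  fixes s t s' t' \<alpha> \<alpha>' :: int
  assumes "b \<ge> (2::nat)" "t \<noteq> 0" "t' \<noteq> 0" "coprime s t" "coprime s' t'"
    and "coprime t (int b)" "coprime t' (int b)"
    and eq: "(of_nat b powi \<alpha> * (of_int s / of_int t) :: rat) = of_nat b powi \<alpha>' * (of_int s' / of_int t')"
  shows "\<bar>t\<bar> = \<bar>t'\<bar>"
proof -
  have *: "\<bar>t\<bar> = \<bar>t'\<bar>"
    if "t \<noteq> 0" "t' \<noteq> 0" "coprime s t" "coprime s' t'" "coprime t (int b)" "coprime t' (int b)"
      "(of_int s / of_int t :: rat) = of_nat b ^ n * (of_int s' / of_int t')" for s t s' t' :: int and n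
  proof -
    have "(of_int (s * t') :: rat) = of_int (int b ^ n * s' * t)"
      using that(1,2,7) by (simp add: field_simps)
    then have eq: "s * t' = int b ^ n * s' * t" by (simp only: of_int_eq_iff)
    have "t dvd s * t'" unfolding eq by simp
    then have "t dvd t'" using that(3) by (simp add: coprime_dvd_mult_right_iff coprime_commute)
    have "t' dvd int b ^ n * (s' * t)" using eq by (metis dvd_triv_right mult.assoc)
    moreover have "coprime t' (int b ^ n)" using that(6) by simp
    ultimately have "t' dvd t"
      using that(4) by (metis coprime_commute coprime_dvd_mult_right_iff)
    with \<open>t dvd t'\<close> show ?thesis by (rule zdvd_antisym_abs)
  qed
  have b0: "(of_nat b :: rat) \<noteq> 0" using assms(1) by simp
  have bp: "(of_nat b powi k :: rat) \<noteq> 0" for k using b0 by simp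
  show ?thesis
  proof (cases "\<alpha> \<le> \<alpha>'")
    case True
    define n where "n = nat (\<alpha>' - \<alpha>)"
    have "(of_nat b powi \<alpha>' :: rat) = of_nat b powi \<alpha> * of_nat b ^ n"
      using True b0 by (simp add: n_def power_int_diff flip: power_int_of_nat)
    then have "(of_int s / of_int t :: rat) = of_nat b ^ n * (of_int s' / of_int t')"
      using eq bp by (simp only: mult.assoc mult_cancel_left simp_thms)
    then show ?thesis by (intro *[of t t' s s' n] assms)
  next
    case False
    define n where "n = nat (\<alpha> - \<alpha>')"
    have "(of_nat b powi \<alpha> :: rat) = of_nat b powi \<alpha>' * of_nat b ^ n"
      using False b0 by (simp add: n_def power_int_diff flip: power_int_of_nat)
    then have "(of_int s' / of_int t' :: rat) = of_nat b ^ n * (of_int s / of_int t)"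
      using eq[symmetric] bp by (simp only: mult.assoc mult_cancel_left simp_thms)
    then show ?thesis by (intro *[of t' t s' s n, symmetric] assms)
  qed
qed

text \<open>\<open>max 1\<close> reconciles length 0 in the case \<open>t = 1\<close> with
  \<open>ord 1 b = 1\<close>. As \<open>t\<close> is coprime to \<open>b\<close>, the exponent 0 of
  \<open>b\<close> is an admissible choice.\<close>

lemma b_length_coprime:
  assumes "b \<ge> 2" "t > 0" "coprime s (int t)" "coprime t b" "\<mu> = of_int s / of_nat t"
  shows "max 1 (b_length b \<mu>) = ord t b"
proof -
  have "b_length b \<mu> = (if t = 1 then 0 else ord t b)"
    unfolding b_length_def
  proof (rule the_equality)
    show "\<exists>\<alpha> s' t' :: int. t' \<noteq> 0 \<and> coprime s' t' \<and> coprime t' (int b) \<and>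
        \<mu> = of_nat b powi \<alpha> * (of_int s' / of_int t') \<and>
        (if t = 1 then 0 else ord t b) = (if \<bar>t'\<bar> = 1 then 0 else ord (nat \<bar>t'\<bar>) b)"
      using assms by (intro exI[of _ 0] exI[of _ s] exI[of _ "int t"]) auto
  next
    fix l
    assume "\<exists>\<alpha> s' t' :: int. t' \<noteq> 0 \<and> coprime s' t' \<and> coprime t' (int b) \<and>
        \<mu> = of_nat b powi \<alpha> * (of_int s' / of_int t') \<and>
        l = (if \<bar>t'\<bar> = 1 then 0 else ord (nat \<bar>t'\<bar>) b)"
    then obtain \<alpha> s' t' where *: "t' \<noteq> 0" "coprime s' t'" "coprime t' (int b)"
      "\<mu> = of_nat b powi \<alpha> * (of_int s' / of_int t')"
      "l = (if \<bar>t'\<bar> = 1 then 0 else ord (nat \<bar>t'\<bar>) b)"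
      by blast
    have "\<bar>t'\<bar> = \<bar>int t\<bar>"
      by (rule b_length_denominator_unique[of b t' "int t" s' s \<alpha> 0]) (use assms * in auto)
    then show "l = (if t = 1 then 0 else ord t b)" using *(5) by auto
  qed
  then show ?thesis using assms(4) by (simp add: max_def Suc_le_eq)
qed

context slope_twist
begin

lemma dvd_shift_exp_iff:
  assumes "coprime s (int t)"
  shows "int t dvd shift_exp i \<longleftrightarrow> ord t b dvd i"
proof -
  have "int t dvd shift_exp i \<longleftrightarrow> int t dvd int b ^ i - 1"
    unfolding shift_exp_def using assms by (simp add: coprime_dvd_mult_left_iff coprime_commute)
  also have "\<dots> \<longleftrightarrow> [int (b ^ i) = int 1] (mod int t)"
    by (simp add: cong_iff_dvd_diff)
  also have "\<dots> \<longleftrightarrow> ord t b dvd i"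
    by (simp only: cong_int_iff ord_divides)
  finally show ?thesis .
qed

text \<open>\<open>ord t b\<close> is 0 when \<open>t\<close> and \<open>b\<close> are not coprime,
  and 0 divides no positive \<open>i\<close>. So a second point on the line rules out common factors
  of \<open>b\<close> and the denominator of the slope.\<close>

lemma coprime_if_dvd_shift_exp:
  assumes "coprime s (int t)" "i > 0" "int t dvd shift_exp i"
  shows "coprime t b"
proof (rule ccontr)
  assume "\<not> coprime t b"
  then have "ord t b = 0" by simp
  then show False using assms dvd_shift_exp_iff[OF assms(1), of i] by simp
qed

end

section \<open>Computing the reduction from a supporting line\<close>

context laurent_skew
begin

text \<open>\<open>above\<close> and \<open>i0\<close> describe a supporting line
  \<open>y = x \<mu> - \<nu>\<close>. Its intercept determines the reduction exponent, and the
  reduction records the coefficients at the heights of this line.\<close>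

lemma coeff_slope_reduction:
  assumes above: "\<And>i. coeff A i \<noteq> 0 \<Longrightarrow> of_nat b ^ i * \<mu> - \<nu> \<le> of_int (fls_subdegree (coeff A i))"
    and i0: "coeff A i0 \<noteq> 0" "of_int (fls_subdegree (coeff A i0)) = of_nat b ^ i0 * \<mu> - \<nu>"
  shows "coeff (slope_reduction \<sigma> b \<mu> A) i = frac_of_fls (coeff A i) (of_nat b ^ i * \<mu> - \<nu>)"
proof -
  note conj = conj_coeff_eq[OF k.f_0 k.f_1 b_pos]
  have val_frac: "frac_has_val (frac_of_fls f) x \<longleftrightarrow> f \<noteq> 0 \<and> x = of_int (fls_subdegree f)" for f :: "'k fls" and x
  proof
    assume v: "frac_has_val (frac_of_fls f) x"
    then have x: "x \<in> \<int>" "fls_nth f \<lfloor>x\<rfloor> \<noteq> 0"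
      by (auto simp: frac_has_val_def frac_of_fls_def split: if_splits)
    then have f: "f \<noteq> 0" "fls_subdegree f \<le> \<lfloor>x\<rfloor>" by (auto intro: fls_subdegree_leI)
    have "frac_of_fls f (of_int (fls_subdegree f)) \<noteq> 0" using f by (simp add: frac_of_fls_def)
    then have "x \<le> of_int (fls_subdegree f)" using v unfolding frac_has_val_def by blast
    moreover have "of_int \<lfloor>x\<rfloor> = x" using x(1) by (auto elim: Ints_cases)
    ultimately show "f \<noteq> 0 \<and> x = of_int (fls_subdegree f)" using f by linarith
  next
    assume "f \<noteq> 0 \<and> x = of_int (fls_subdegree f)"
    then show "frac_has_val (frac_of_fls f) x"
      by (auto simp: frac_has_val_def frac_of_fls_def intro: fls_subdegree_leI elim!: Ints_cases split: if_splits)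
  qed
  have "frac_has_val (conj_coeff \<sigma> b \<nu>' \<mu> A i) x \<longleftrightarrow>
      frac_has_val (frac_of_fls (coeff A i)) (x - \<nu>' + of_nat b ^ i * \<mu>)" for \<nu>' i x
  proof -
    have "(\<forall>q. frac_of_fls (coeff A i) (q - \<nu>' + of_nat b ^ i * \<mu>) \<noteq> 0 \<longrightarrow> x \<le> q) \<longleftrightarrow>
        (\<forall>q. frac_of_fls (coeff A i) q \<noteq> 0 \<longrightarrow> x - \<nu>' + of_nat b ^ i * \<mu> \<le> q)"
      (is "?L \<longleftrightarrow> ?R")
    proof
      assume L: ?L
      show ?R
      proof (intro allI impI)
        fix q assume "frac_of_fls (coeff A i) q \<noteq> 0"
        then have "x \<le> q + \<nu>' - of_nat b ^ i * \<mu>"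
          using L[rule_format, of "q + \<nu>' - of_nat b ^ i * \<mu>"] by simp
        then show "x - \<nu>' + of_nat b ^ i * \<mu> \<le> q" by simp
      qed
    qed force
    then show ?thesis by (simp add: frac_has_val_def conj)
  qed
  then have val: "frac_has_val (conj_coeff \<sigma> b \<nu>' \<mu> A i) x \<longleftrightarrow>
      coeff A i \<noteq> 0 \<and> x = of_int (fls_subdegree (coeff A i)) + \<nu>' - of_nat b ^ i * \<mu>" for \<nu>' i x
    by (auto simp: val_frac)
  have "reduction_exponent \<sigma> b \<mu> A = \<nu>"
    unfolding reduction_exponent_def
  proof (rule the_equality)
    show "skew_has_val (conj_coeff \<sigma> b \<nu> \<mu> A) 0"
      using above i0 unfolding skew_has_val_def val by (force simp: algebra_simps)
  next
    \<comment> \<open>The point at \<open>i0\<close> yields \<open>\<nu> \<le> \<nu>'\<close>, and a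
      coefficient of valuation exactly 0 yields the converse.\<close>
    fix \<nu>' assume v: "skew_has_val (conj_coeff \<sigma> b \<nu>' \<mu> A) 0"
    then have "0 \<le> of_int (fls_subdegree (coeff A i0)) + \<nu>' - of_nat b ^ i0 * \<mu>"
      using i0(1) unfolding skew_has_val_def val by blast
    then have "\<nu> \<le> \<nu>'" using i0(2) by simp
    obtain i where "coeff A i \<noteq> 0" "0 = of_int (fls_subdegree (coeff A i)) + \<nu>' - of_nat b ^ i * \<mu>"
      using v unfolding skew_has_val_def val by blast
    then have "\<nu>' \<le> \<nu>" using above[of i] by simp
    then show "\<nu>' = \<nu>" using \<open>\<nu> \<le> \<nu>'\<close> by simp
  qed
  then have "coeff (slope_reduction \<sigma> b \<mu> A) i =
      (\<Sum>j\<le>degree A. if j = i then frac_of_fls (coeff A i) (of_nat b ^ i * \<mu> - \<nu>) else 0)"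
    unfolding slope_reduction_def coeff_sum
    by (intro sum.cong) (auto simp: conj)
  then show ?thesis by (auto simp: coeff_eq_0 frac_of_fls_def)
qed

end

context slope_twist
begin

text \<open>The line through the point at \<open>T^0\<close> has \<open>\<nu> = \<mu> - v\<close>,
  and its height at index \<open>i\<close> is \<open>(t v + shift_exp i) / t\<close>, which the
  twist moves to the constant \<open>w\<close>-exponent \<open>t v\<close>. Where this height is not
  an integer, both sides vanish.\<close>

lemma coeff_slope_reduction_twist:
  assumes above: "\<And>i. coeff A i \<noteq> 0 \<Longrightarrow>
      of_int v + (of_nat b ^ i - 1) * (of_int s / of_nat t) \<le> (of_int (fls_subdegree (coeff A i)) :: rat)"
    and "coeff A 0 \<noteq> 0" "fls_subdegree (coeff A 0) = v"
  shows "slope_reduction \<sigma> b (of_int s / of_nat t) A = digit (int t * v) (twist A)"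
proof (rule poly_eqI)
  fix i
  let ?\<mu> = "of_int s / of_nat t :: rat"
  have "coeff (slope_reduction \<sigma> b ?\<mu> A) i =
      frac_of_fls (coeff A i) (of_nat b ^ i * ?\<mu> - (?\<mu> - of_int v))"
    by (rule coeff_slope_reduction[of A ?\<mu> "?\<mu> - of_int v" 0])
      (use assms in \<open>auto simp: algebra_simps\<close>)
  also have "of_nat b ^ i * ?\<mu> - (?\<mu> - of_int v) = of_int (int t * v + shift_exp i) / of_int (int t)"
    using t_pos by (simp add: shift_exp_def field_simps)
  also have "frac_of_fls (coeff A i) (of_int (int t * v + shift_exp i) / of_int (int t)) =
      coeff (digit (int t * v) (twist A)) i"
  proof (cases "int t dvd int t * v + shift_exp i")
    case True
    then obtain e where e: "int t * v + shift_exp i = int t * e" by (elim dvdE)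
    then have "(of_int (int t * v + shift_exp i) / of_int (int t) :: rat) = of_int e"
      unfolding e using t_pos by simp
    then show ?thesis using e True t_pos by (simp add: frac_of_fls_def nth_twist_coeff)
  next
    case False
    have "(of_int (int t * v + shift_exp i) / of_int (int t) :: rat) \<notin> \<int>"
    proof
      assume "(of_int (int t * v + shift_exp i) / of_int (int t) :: rat) \<in> \<int>"
      then obtain e where "(of_int (int t * v + shift_exp i) / of_int (int t) :: rat) = of_int e"
        by (elim Ints_cases)
      then have "(of_int (int t * v + shift_exp i) :: rat) = of_int (int t * e)"
        using t_pos by (simp add: field_simps)
      then have "int t * v + shift_exp i = int t * e" by (simp only: of_int_eq_iff)
      then show False using False by simp
    qed
    then show ?thesis using False by (simp only: frac_of_fls_def coeff_digit coeff_twist nth_twist_coeff if_False)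
  qed
  finally show "coeff (slope_reduction \<sigma> b ?\<mu> A) i = coeff (digit (int t * v) (twist A)) i" .
qed

lemma subdegree_twist_coeff:
  assumes "f \<noteq> 0"
  shows "fls_subdegree (twist_coeff i f) = int t * fls_subdegree f - shift_exp i"
proof -
  have "fls_nth (twist_coeff i f) n = 0" if "n < int t * fls_subdegree f - shift_exp i" for n
  proof (cases "int t dvd n + shift_exp i")
    case True
    then obtain e where e: "n + shift_exp i = int t * e" by (elim dvdE)
    then have "int t * e < int t * fls_subdegree f" using that by simp
    then have "e < fls_subdegree f" using t_pos by simp
    then show ?thesis using e t_pos by (simp add: nth_twist_coeff)
  qed (simp add: nth_twist_coeff)
  moreover have "fls_nth (twist_coeff i f) (int t * fls_subdegree f - shift_exp i) \<noteq> 0"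
    using assms by (simp flip: nth_eq_nth_twist_coeff)
  ultimately show ?thesis by (intro fls_subdegree_eqI) auto
qed

text \<open>Clearing the denominator and shifting turns a line of slope \<open>s / t\<close> into a
  horizontal one.\<close>

lemma le_subdegree_iff_twist:
  assumes "f \<noteq> 0"
  shows "of_int v + (of_nat b ^ i - 1) * (of_int s / of_nat t) \<le> (of_int (fls_subdegree f) :: rat) \<longleftrightarrow>
    int t * v \<le> fls_subdegree (twist_coeff i f)"
    and "(of_int (fls_subdegree f) :: rat) = of_int v + (of_nat b ^ i - 1) * (of_int s / of_nat t) \<longleftrightarrow>
    fls_subdegree (twist_coeff i f) = int t * v"
proof -
  have *: "of_int v + (of_nat b ^ i - 1) * (of_int s / of_nat t) =
      (of_int (int t * v + shift_exp i) / of_nat t :: rat)"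
    using t_pos by (simp add: shift_exp_def field_simps)
  have "of_int v + (of_nat b ^ i - 1) * (of_int s / of_nat t) \<le> (of_int (fls_subdegree f) :: rat) \<longleftrightarrow>
      (of_int (int t * v + shift_exp i) :: rat) \<le> of_int (int t * fls_subdegree f)"
    unfolding * using t_pos by (simp add: field_simps del: of_int_add)
  then show "of_int v + (of_nat b ^ i - 1) * (of_int s / of_nat t) \<le> (of_int (fls_subdegree f) :: rat) \<longleftrightarrow>
    int t * v \<le> fls_subdegree (twist_coeff i f)"
    unfolding of_int_le_iff by (simp add: subdegree_twist_coeff[OF assms] algebra_simps)
  have "(of_int (fls_subdegree f) :: rat) = of_int v + (of_nat b ^ i - 1) * (of_int s / of_nat t) \<longleftrightarrow>
      (of_int (int t * fls_subdegree f) :: rat) = of_int (int t * v + shift_exp i)"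
    unfolding * using t_pos by (simp add: field_simps del: of_int_add)
  then show "(of_int (fls_subdegree f) :: rat) = of_int v + (of_nat b ^ i - 1) * (of_int s / of_nat t) \<longleftrightarrow>
    fls_subdegree (twist_coeff i f) = int t * v"
    unfolding of_int_eq_iff by (auto simp add: subdegree_twist_coeff[OF assms] algebra_simps)
qed

end

section \<open>Irreducibility\<close>

context field_endomorphism
begin

text \<open>\<open>T\<close> splits off on the right, so the cofactor must be constant.\<close>

lemma irred_divisible_by_T:
  assumes "ring_irred (skew_poly_ring f) A" "coeff A 0 = 0"
  shows "\<exists>c. c \<noteq> 0 \<and> A = [:0, c:]"
proof -
  define B where "B = poly_shift 1 A"
  have A: "A = skew_mult f B (monom 1 1)"
    using assms(2) by (intro poly_eqI) (auto simp: coeff_mult_monom_1 B_def coeff_poly_shift Suc_le_eq)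
  note irr = assms(1)[unfolded ring_irred_skew_iff]
  have "degree B = 0" using irr[THEN conjunct2, rule_format, OF A] by (simp add: degree_monom_eq)
  then obtain c where c: "B = [:c:]" by (rule degree_eq_zeroE)
  have "A = [:0, c:]"
    unfolding A c const_mult by (simp add: monom_Suc smult_monom)
  moreover have "c \<noteq> 0" using irr calculation by auto
  ultimately show ?thesis by blast
qed

section \<open>Powers of the Frobenius as field endomorphisms\<close>

lemma inj_f: "inj f"
proof
  fix x y assume "f x = f y"
  then have "f (x - y) = 0" using f_add[of "x - y" y] by simp
  then show "x = y" by (simp add: f_eq_0_iff)
qed

lemma field_endomorphism_funpow: "field_endomorphism (f ^^ n)"
  by standard (simp_all add: funpow_add funpow_mult)

lemma field_endomorphism_inv:
  assumes "surj f"
  shows "field_endomorphism (inv_into UNIV f)"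
proof
  have inv: "inv_into UNIV f (f x) = x" for x using inj_f by simp
  show "inv_into UNIV f (x + y) = inv_into UNIV f x + inv_into UNIV f y" for x y
    using inv[of "inv_into UNIV f x + inv_into UNIV f y"] assms by (simp add: f_add surj_f_inv_f)
  show "inv_into UNIV f (x * y) = inv_into UNIV f x * inv_into UNIV f y" for x y
    using inv[of "inv_into UNIV f x * inv_into UNIV f y"] assms by (simp add: f_mult surj_f_inv_f)
  show "inv_into UNIV f 1 = 1" using inv[of 1] by (simp add: f_1)
qed

end

text \<open>The freshman's dream makes the Frobenius additive; perfectness supplies its inverse,
  which covers the negative powers.\<close>

lemma field_endomorphism_frobenius_power:
  fixes \<sigma> :: "'k::field \<Rightarrow> 'k"
  assumes "prime p" "perfect_of_char p TYPE('k)" "frobenius_power p \<sigma>"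
  shows "field_endomorphism \<sigma>"
proof -
  have char: "CHAR('k) = p" and surj: "surj (frobenius p :: 'k \<Rightarrow> 'k)"
    using assms(2) by (auto simp: perfect_of_char_def)
  interpret F: field_endomorphism "frobenius p :: 'k \<Rightarrow> 'k"
    using assms(1) freshmans_dream[where 'a = 'k] char
    by unfold_locales (auto simp: frobenius_def power_mult_distrib)
  interpret I: field_endomorphism "inv_into UNIV (frobenius p :: 'k \<Rightarrow> 'k)"
    using surj by (rule F.field_endomorphism_inv)
  show ?thesis
    using assms(3) F.field_endomorphism_funpow I.field_endomorphism_funpow by (auto simp: frobenius_power_def)
qed

section \<open>Transfer of irreducibility between a polynomial and its reduction\<close>

context slope_twist
begin

lemma twist_coeff_shift: "twist_coeff i (fls_shift v f) = fls_shift (int t * v) (twist_coeff i f)"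
  by (simp add: twist_coeff_def t_pos add.commute)

text \<open>The factorization of the reduction lifts to one of \<open>A\<close> whose right factor
  has degree \<open>degree C0\<close>; as this is positive, irreducibility makes the left factor
  constant.\<close>

lemma right_factor_of_reduction_full:
  assumes l: "\<And>i. int t dvd shift_exp i \<longleftrightarrow> l dvd i"
    and irr: "ring_irred (skew_poly_ring (phi \<sigma> b)) A"
    and low: "\<And>i n. n < int t * v \<Longrightarrow> fls_nth (coeff (twist A) i) n = 0"
    and red: "digit (int t * v) (twist A) = skew_mult \<sigma> B0 C0"
    and nz: "coeff (digit (int t * v) (twist A)) 0 \<noteq> 0"
    and supp: "\<And>i. coeff B0 i \<noteq> 0 \<Longrightarrow> l dvd i" "\<And>i. coeff C0 i \<noteq> 0 \<Longrightarrow> l dvd i"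
    and C0: "degree C0 > 0"
  shows "degree C0 = degree A"
proof -
  \<comment> \<open>Scaling by \<open>u^(-v)\<close> before twisting lowers the
    \<open>w\<close>-exponents by \<open>t v\<close>, so the lowest digit becomes digit 0 while the
    polynomial stays in the image of \<open>twist\<close>.\<close>
  define A1 where "A1 = twist (Polynomial.smult (fls_X_intpow (- v)) A)"
  have coeff_A1: "coeff A1 i = fls_shift (int t * v) (coeff (twist A) i)" for i
    unfolding A1_def coeff_twist coeff_smult_X_intpow by (simp add: twist_coeff_shift)
  have "digit 0 A1 = skew_mult \<sigma> B0 C0"
    unfolding red[symmetric] by (rule poly_eqI) (simp add: coeff_A1 del: coeff_twist)
  moreover have "integral_fls (coeff A1 i)" for i
    unfolding coeff_A1 integral_fls_def using low by (simp del: coeff_twist)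
  moreover have "coeff B0 0 \<noteq> 0"
    using nz unfolding red k.coeff_0_mult by auto
  ultimately obtain B C where BC: "A1 = skew_mult (phi \<sigma> b) B C" "supported B" "supported C"
      "degree C = degree C0"
    using hensel_factors[OF l, of A1 B0 C0] supp C0 supported_twist unfolding A1_def by blast
  obtain B' C' where BC': "twist B' = B" "twist C' = C"
    using BC(2,3) twist_surj by metis
  have "Polynomial.smult (fls_X_intpow (- v)) A = skew_mult (phi \<sigma> b) B' C'"
    using BC(1) unfolding A1_def BC'[symmetric] twist_mult[symmetric] inj_twist .
  then have "Polynomial.smult (fls_X_intpow v) (Polynomial.smult (fls_X_intpow (- v)) A) =
      skew_mult (phi \<sigma> b) (Polynomial.smult (fls_X_intpow v) B') C'"
    by (simp only: K.smult_mult)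
  then have A: "A = skew_mult (phi \<sigma> b) (Polynomial.smult (fls_X_intpow v) B') C'"
    by (simp add: fls_X_intpow_times_conv_shift)
  have "A \<noteq> 0" using nz by auto
  have "degree (Polynomial.smult (fls_X_intpow v) B') = 0 \<or> degree C' = 0"
    by (rule irr[unfolded K.ring_irred_skew_iff, THEN conjunct2, rule_format, OF A])
  moreover have degC': "degree C' = degree C0" using BC(4) BC'(2) degree_twist[of C'] by simp
  ultimately have "degree (Polynomial.smult (fls_X_intpow v) B') = 0" using C0 by simp
  moreover have "Polynomial.smult (fls_X_intpow v) B' \<noteq> 0" "C' \<noteq> 0"
    using A \<open>A \<noteq> 0\<close> K.mult_zero_left K.mult_zero_right by metis+
  ultimately have "degree A = degree C'"
    using K.degree_mult A by (metis add_0)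
  then show ?thesis using degC' by simp
qed

end

lemma ex_int_fraction:
  fixes \<mu> :: rat
  obtains s and t :: nat where "t > 0" "coprime s (int t)" "\<mu> = of_int s / of_nat t"
proof -
  obtain s t' where q: "quotient_of \<mu> = (s, t')" by fastforce
  have "t' > 0" "coprime s t'" "\<mu> = of_int s / of_int t'"
    using quotient_of_denom_pos[OF q] quotient_of_coprime[OF q] quotient_of_div[OF q] by auto
  then show ?thesis using that[of "nat t'" s] by simp
qed

context slope_twist
begin

text \<open>Here \<open>s / t\<close> is the first slope of the Newton polygon, not necessarily the only one.\<close>

lemma irred_iff_first_slope:
  fixes A :: "'k fls poly" and \<mu> :: rat and v :: int
  defines "\<mu> \<equiv> of_int s / of_nat t" and "v \<equiv> fls_subdegree (coeff A 0)"
  assumes st: "coprime s (int t)" and a0: "coeff A 0 \<noteq> 0"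
    and above: "\<And>i. coeff A i \<noteq> 0 \<Longrightarrow>
      of_int v + (of_nat b ^ i - 1) * \<mu> \<le> of_int (fls_subdegree (coeff A i))"
    and j: "j > 0" "coeff A j \<noteq> 0"
      "of_int (fls_subdegree (coeff A j)) = of_int v + (of_nat b ^ j - 1) * \<mu>"
  shows "ring_irred (skew_poly_ring (phi \<sigma> b)) A \<longleftrightarrow>
    on_slope b A 0 \<mu> \<and>
    ring_irred (skew_power_subring \<sigma> (max 1 (b_length b \<mu>))) (slope_reduction \<sigma> b \<mu> A)"
proof -
  define R where "R = digit (int t * v) (twist A)"
  have degA: "degree A > 0" using le_degree[OF j(2)] j(1) by simp
  then have lead: "lead_coeff A \<noteq> 0" by auto
  have sub_ge: "int t * v \<le> fls_subdegree (twist_coeff i (coeff A i))" if "coeff A i \<noteq> 0" for i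
    using above[OF that] le_subdegree_iff_twist(1)[OF that] by (simp add: \<mu>_def)
  have low: "fls_nth (coeff (twist A) i) n = 0" if "n < int t * v" for i n
  proof (cases "coeff A i = 0")
    case False
    then have "n < fls_subdegree (twist_coeff i (coeff A i))" using sub_ge[of i] that by simp
    then show ?thesis by simp
  qed simp
  have touch: "coeff R i \<noteq> 0 \<longleftrightarrow>
      of_int (fls_subdegree (coeff A i)) = of_int v + (of_nat b ^ i - 1) * \<mu>" if "coeff A i \<noteq> 0" for i
  proof -
    have "coeff R i \<noteq> 0 \<longleftrightarrow> fls_subdegree (twist_coeff i (coeff A i)) = int t * v"
    proof
      assume "coeff R i \<noteq> 0"
      then have "fls_subdegree (twist_coeff i (coeff A i)) \<le> int t * v"
        by (intro fls_subdegree_leI) (simp add: R_def)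
      then show "fls_subdegree (twist_coeff i (coeff A i)) = int t * v"
        using sub_ge[OF that] by simp
    next
      assume *: "fls_subdegree (twist_coeff i (coeff A i)) = int t * v"
      have "twist_coeff i (coeff A i) \<noteq> 0" using that by simp
      then show "coeff R i \<noteq> 0"
        unfolding R_def coeff_digit coeff_twist *[symmetric] by (rule nth_fls_subdegree_nonzero)
    qed
    then show ?thesis using le_subdegree_iff_twist(2)[OF that] by (simp add: \<mu>_def)
  qed
  have R0: "coeff R 0 \<noteq> 0" using touch[OF a0] by (simp add: v_def)
  have Rj: "coeff R j \<noteq> 0" using touch[OF j(2)] j(3) by simp
  have R_supp: "int t dvd shift_exp i" if "coeff R i \<noteq> 0" for i
  proof -
    have "int t dvd int t * v + shift_exp i"
      using that by (intro supportedD[OF supported_twist[of A]]) (simp add: R_def del: coeff_twist)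
    then show ?thesis using dvd_add_right_iff dvd_triv_left by blast
  qed
  have tb: "coprime t b"
    using coprime_if_dvd_shift_exp[OF st j(1) R_supp[OF Rj]] .
  note l = dvd_shift_exp_iff[OF st]
  have len: "max 1 (b_length b \<mu>) = ord t b"
    by (rule b_length_coprime[OF b_ge_2 t_pos st tb]) (simp add: \<mu>_def)
  have red: "slope_reduction \<sigma> b \<mu> A = R"
    unfolding R_def \<mu>_def
    by (rule coeff_slope_reduction_twist) (use above a0 in \<open>auto simp: v_def \<mu>_def\<close>)
  \<comment> \<open>The lower bound is already known, so being monoclinic only asks that the last
    point lie on the line.\<close>
  have on_slope: "on_slope b A 0 \<mu> \<longleftrightarrow> coeff R (degree A) \<noteq> 0"
    unfolding on_slope_def using degA a0 above touch[OF lead] by (auto simp: v_def)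
  show ?thesis
    unfolding len red on_slope
  proof
    assume irr: "ring_irred (skew_poly_ring (phi \<sigma> b)) A"
    have full: "degree C0 = degree A"
      if "R = skew_mult \<sigma> B0 C0" "\<And>i. coeff B0 i \<noteq> 0 \<Longrightarrow> ord t b dvd i"
        "\<And>i. coeff C0 i \<noteq> 0 \<Longrightarrow> ord t b dvd i" "degree C0 > 0" for B0 C0
      by (rule right_factor_of_reduction_full[OF l irr low, of v B0 C0])
        (use that R0 in \<open>auto simp: R_def\<close>)
    have R_pos: "degree R > 0" using le_degree[OF Rj] j(1) by simp
    \<comment> \<open>The trivial factorization of \<open>R\<close> with left factor 1 lifts too,
      which forces the line to reach the last vertex.\<close>
    have degR: "degree R = degree A"
      by (rule full[of 1]) (use R_supp l R_pos in auto)
    show "coeff R (degree A) \<noteq> 0 \<and> ring_irred (skew_power_subring \<sigma> (ord t b)) R"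
    proof
      show "coeff R (degree A) \<noteq> 0" using degR R_pos by (metis leading_coeff_0_iff degree_0 less_numeral_extra(3))
      show "ring_irred (skew_power_subring \<sigma> (ord t b)) R"
        unfolding k.ring_irred_power_subring_iff
      proof (intro conjI allI impI)
        fix B0 C0
        assume *: "\<forall>i. coeff B0 i \<noteq> 0 \<longrightarrow> ord t b dvd i" "\<forall>i. coeff C0 i \<noteq> 0 \<longrightarrow> ord t b dvd i"
          "R = skew_mult \<sigma> B0 C0"
        have nz: "B0 \<noteq> 0" "C0 \<noteq> 0" using *(3) R0 by auto
        \<comment> \<open>If \<open>C0\<close> is not constant, it has the full degree of
          \<open>R\<close>, and additivity of degrees makes \<open>B0\<close> constant.\<close>
        show "degree B0 = 0 \<or> degree C0 = 0"
          using full[OF *(3)] * k.degree_mult[OF nz] degR by fastforce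
      qed (use R_supp l R_pos in auto)
    qed
  next
    assume *: "coeff R (degree A) \<noteq> 0 \<and> ring_irred (skew_power_subring \<sigma> (ord t b)) R"
    show "ring_irred (skew_poly_ring (phi \<sigma> b)) A"
      unfolding K.ring_irred_skew_iff
    proof (intro conjI allI impI degA)
      fix B C assume A: "A = skew_mult (phi \<sigma> b) B C"
      obtain B0 C0 where "R = skew_mult \<sigma> B0 C0" "degree B0 = degree B" "degree C0 = degree C"
          "\<forall>i. coeff B0 i \<noteq> 0 \<longrightarrow> ord t b dvd i" "\<forall>i. coeff C0 i \<noteq> 0 \<longrightarrow> ord t b dvd i"
        using reduction_of_product[OF l A low, of "int t * v"] R0 * by (auto simp: R_def)
      then show "degree B = 0 \<or> degree C = 0"
        using * unfolding k.ring_irred_power_subring_iff by metis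
    qed
  qed
qed

end

context laurent_skew
begin

lemma irred_iff_reduction_irred:
  fixes A :: "'k fls poly"
  assumes not_T: "\<not> (\<exists>c. c \<noteq> 0 \<and> A = [:0, c:])"
  shows "ring_irred (skew_poly_ring (phi \<sigma> b)) A \<longleftrightarrow>
    (\<exists>\<mu> :: rat. \<exists>i0. on_slope b A i0 \<mu> \<and>
       ring_irred (skew_power_subring \<sigma> (max 1 (b_length b \<mu>))) (slope_reduction \<sigma> b \<mu> A))"
    (is "?irr \<longleftrightarrow> (\<exists>\<mu> i0. ?rhs \<mu> i0)")
proof
  assume irr: ?irr
  have a0: "coeff A 0 \<noteq> 0" using K.irred_divisible_by_T[OF irr] not_T by blast
  define I where "I = {i. coeff A i \<noteq> 0} - {0}"
  have "degree A > 0" using irr unfolding K.ring_irred_skew_iff by blast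
  then have "degree A \<in> I" by (auto simp: I_def)
  moreover have "finite I"
    by (rule finite_subset[of _ "{..degree A}"]) (auto simp: I_def intro: le_degree)
  moreover have "1 < (of_nat b ^ i :: rat)" if "i \<in> I" for i
    using that b_ge_2 by (intro one_less_power) (auto simp: I_def)
  \<comment> \<open>The base point has abscissa \<open>b^0 = 1\<close>; \<open>\<mu>\<close> is the
    first slope, whether or not others follow.\<close>
  ultimately obtain \<mu> :: rat and j where \<mu>: "j \<in> I"
      "of_int (fls_subdegree (coeff A j)) = of_int (fls_subdegree (coeff A 0)) + (of_nat b ^ j - 1) * \<mu>"
      "\<And>i. i \<in> I \<Longrightarrow> of_int (fls_subdegree (coeff A 0)) + (of_nat b ^ i - 1) * \<mu>
         \<le> of_int (fls_subdegree (coeff A i))"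
    using ex_supporting_slope[of I 1 "\<lambda>i. of_nat b ^ i" "\<lambda>i. of_int (fls_subdegree (coeff A i))"
        "of_int (fls_subdegree (coeff A 0)) :: rat"] by blast
  obtain s and t :: nat where st: "t > 0" "coprime s (int t)" "\<mu> = of_int s / of_nat t"
    by (rule ex_int_fraction)
  interpret slope_twist \<sigma> b s t by unfold_locales (rule st)
  have "of_int (fls_subdegree (coeff A 0)) + (of_nat b ^ i - 1) * \<mu>
      \<le> of_int (fls_subdegree (coeff A i))" if "coeff A i \<noteq> 0" for i
    using \<mu>(3)[of i] that by (cases "i = 0") (auto simp: I_def)
  then have "?irr \<longleftrightarrow> ?rhs \<mu> 0"
    using \<mu>(1,2) unfolding st(3)
    by (intro irred_iff_first_slope[OF st(2) a0, where j = j]) (auto simp: I_def)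
  then have "?rhs \<mu> 0" using irr by blast
  then show "\<exists>\<mu> i0. ?rhs \<mu> i0" by blast
next
  assume "\<exists>\<mu> i0. ?rhs \<mu> i0"
  then obtain \<mu> i0 where rhs: "on_slope b A i0 \<mu>"
    "ring_irred (skew_power_subring \<sigma> (max 1 (b_length b \<mu>))) (slope_reduction \<sigma> b \<mu> A)" by blast
  note os = rhs(1)[unfolded on_slope_def]
  \<comment> \<open>With \<open>i0 > 0\<close> the reduction would have lowest exponent
    \<open>i0\<close>, hence by irreducibility degree \<open>i0\<close>; but the last vertex also
    lies on the line and contributes in degree \<open>degree A > i0\<close>.\<close>
  have "i0 = 0"
  proof (rule ccontr)
    assume "i0 \<noteq> 0"
    define \<nu> where "\<nu> = of_nat b ^ i0 * \<mu> - of_int (fls_subdegree (coeff A i0))"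
    have red: "coeff (slope_reduction \<sigma> b \<mu> A) i = frac_of_fls (coeff A i) (of_nat b ^ i * \<mu> - \<nu>)" for i
      by (rule coeff_slope_reduction[of A \<mu> \<nu> i0]) (use os in \<open>auto simp: \<nu>_def algebra_simps\<close>)
    have nz: "coeff (slope_reduction \<sigma> b \<mu> A) i \<noteq> 0"
      if "coeff A i \<noteq> 0" "of_nat b ^ i * \<mu> - \<nu> = of_int (fls_subdegree (coeff A i))" for i
      unfolding red that(2) using that(1) by (simp add: frac_of_fls_def)
    have "degree (slope_reduction \<sigma> b \<mu> A) = i0"
    proof (rule k.degree_eq_lowest_if_irred[OF rhs(2)])
      show "coeff (slope_reduction \<sigma> b \<mu> A) i0 \<noteq> 0"
        by (rule nz) (use os in \<open>auto simp: \<nu>_def\<close>)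
      show "coeff (slope_reduction \<sigma> b \<mu> A) i = 0" if "i < i0" for i
        unfolding red using os that by (simp add: frac_of_fls_def)
    qed (use \<open>i0 \<noteq> 0\<close> in simp)
    moreover have "coeff (slope_reduction \<sigma> b \<mu> A) (degree A) \<noteq> 0"
      by (rule nz) (use os in \<open>auto simp: \<nu>_def algebra_simps\<close>)
    ultimately show False using le_degree os by fastforce
  qed
  note os = os[unfolded this]
  obtain s and t :: nat where st: "t > 0" "coprime s (int t)" "\<mu> = of_int s / of_nat t"
    by (rule ex_int_fraction)
  interpret slope_twist \<sigma> b s t by unfold_locales (rule st)
  show ?irr
    by (rule irred_iff_first_slope[THEN iffD2, of A "degree A"])
      (use os rhs \<open>i0 = 0\<close> st in auto)
qed

end

text \<open>The polynomials \<open>c T\<close> are set apart because they are irreducible while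
  their Newton polygon is a single point and has no slope. For length 0 the subring must contain all
  powers of \<open>T\<close>, whereas divisibility by 0 would leave only constants; hence
  \<open>max 1 l\<close>.\<close>

theorem theorem4p4:
  fixes p b :: nat and \<sigma> :: "'k::field \<Rightarrow> 'k" and A :: "'k fls poly"
  assumes "prime p"
    and "perfect_of_char p TYPE('k)"
    and "frobenius_power p \<sigma>"
    and "b \<ge> 2"
    and "\<not> (\<exists>c. c \<noteq> 0 \<and> A = [:0, c:])"
  shows "ring_irred (skew_poly_ring (phi \<sigma> b)) A \<longleftrightarrow>
    (\<exists>(\<mu>::rat) l. monoclinic_of_slope b A \<mu> \<and> b_length b \<mu> = l \<and>
       ring_irred (skew_power_subring \<sigma> (max 1 l)) (slope_reduction \<sigma> b \<mu> A))"
proof -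
  interpret field_endomorphism \<sigma> using assms(1-3) by (rule field_endomorphism_frobenius_power)
  interpret laurent_skew \<sigma> b by unfold_locales (rule assms(4))
  show ?thesis
    unfolding irred_iff_reduction_irred[OF assms(5)] monoclinic_iff_on_slope[OF assms(4)] by blast
qed

end
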